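(* Let $d\geq 1$, let $p\in[0,1]$ with $p<p_d=\frac{2d+1}{4d}$, let $(S_n)$ be the $d$-dimensional elephant random walk with memory parameter $p$, let $a=\frac{2dp-1}{2d-1}$, and let $G_n=\frac{1}{n}\sum_{k=1}^n S_k$. Then $$\frac{1}{\sqrt{n}}G_n\xrightarrow{\ \mathcal{L}\ }\mathcal{N}\Bigl(0,\frac{2}{3(1-2a)(2-a)d}I_d\Bigr)$$ as $n\to\infty$, where $I_d$ is the identity matrix of order $d$.
   Context: The $d$-dimensional elephant random walk (ERW) with memory parameter $p\in[0,1]$ is defined as follows. Let $e_1,\dots,e_d$ be the standard basis of $\mathbb{R}^d$; the $2d$ directions are $\pm e_1,\dots,\pm e_d$. Set $S_0=0$. The first step $X_1$ is uniformly distributed on the $2d$ directions. For $n\geq 1$, given $X_1,\dots,X_n$, an index $k$ is chosen uniformly at random in $\{1,\dots,n\}$, and then $X_{n+1}=X_k$ with probability $p$, while $X_{n+1}$ equals each of the $2d-1$ remaining directions with probability $(1-p)/(2d-1)$. The position is $S_{n+1}=S_n+X_{n+1}$. $\xrightarrow{\mathcal{L}}$ denotes convergence in distribution. *)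

theory Defs
  imports "HOL-Probability.Probability"
begin

text \<open>Directions: a direction is a pair (i, b) standing for +e_i (b = True)
  or -e_i (b = False); the index type 'd (finite) has CARD('d) = d elements,
  so there are 2d directions.\<close>

definition dir_vec :: "'d::finite \<times> bool \<Rightarrow> real ^ 'd" where
  "dir_vec x = (if snd x then 1 else -1) *\<^sub>R axis (fst x) 1"

definition erw_next :: "real \<Rightarrow> ('d::finite \<times> bool) list \<Rightarrow> ('d \<times> bool) pmf" where
  "erw_next p xs =
     (if xs = [] then pmf_of_set UNIV
      else do {
        k \<leftarrow> pmf_of_set {0..<length xs};
        b \<leftarrow> bernoulli_pmf p;
        (if b then return_pmf (xs ! k) else pmf_of_set (UNIV - {xs ! k}))
      })"

primrec erw_steps :: "real \<Rightarrow> nat \<Rightarrow> ('d::finite \<times> bool) list pmf" where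
  "erw_steps p 0 = return_pmf []"
| "erw_steps p (Suc n) = do { xs \<leftarrow> erw_steps p n; x \<leftarrow> erw_next p xs; return_pmf (xs @ [x]) }"

definition erw_pos :: "('d::finite \<times> bool) list \<Rightarrow> nat \<Rightarrow> real ^ 'd" where
  "erw_pos xs k = (\<Sum>j<k. dir_vec (xs ! j))"

definition erw_center :: "('d::finite \<times> bool) list \<Rightarrow> nat \<Rightarrow> real ^ 'd" where
  "erw_center xs n = (1 / real n) *\<^sub>R (\<Sum>k=1..n. erw_pos xs k)"

definition normal_iso :: "real \<Rightarrow> (real ^ 'd::finite) measure" where
  "normal_iso s2 = density lborel (\<lambda>x. ennreal (\<Prod>i\<in>UNIV. normal_density 0 (sqrt s2) (x $ i)))"

definition conv_in_distr :: "(nat \<Rightarrow> 'a::topological_space measure) \<Rightarrow> 'a measure \<Rightarrow> bool" where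
  "conv_in_distr M N \<longleftrightarrow>
     (\<forall>f::'a \<Rightarrow> real. continuous_on UNIV f \<and> bounded (range f) \<longrightarrow>
        (\<lambda>n. integral\<^sup>L (M n) f) \<longlonglongrightarrow> integral\<^sup>L N f)"

end

theory Submission
  imports Defs
begin

text \<open>Fix \<open>u\<close> and let \<open>T m\<close> be the projection of the position after \<open>m\<close> steps on \<open>u\<close>.
  Since the next step has conditional mean \<open>(a / m) * T m\<close>, conditioning \<open>T 1 + \<dots> + T n\<close> on the
  first \<open>m\<close> steps gives a martingale in \<open>m\<close> with increments \<open>b m n * \<epsilon> m\<close>, where \<open>b m n\<close> is
  deterministic and \<open>\<epsilon> m\<close> is bounded, centered, and has conditional variance tending to
  \<open>|u|\<^sup>2 / d\<close> in mean, by second moment bounds that need \<open>a < 1 / 2\<close>. A second order expansion,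
  one step at a time, yields the limit of the characteristic function; the asymptotics of
  the sum of the \<open>(b m n)\<^sup>2\<close> follow from a linear recursion in \<open>n\<close> rather than from a closed
  form, which would degenerate at \<open>a = -1\<close>. Weak convergence in dimension \<open>d\<close> follows from
  convergence of characteristic functions, a uniform second moment bound and the
  Stone--Weierstrass theorem.\<close>

section \<open>Asymptotics of linear recursions\<close>

text \<open>Outside a band of half-width \<open>\<epsilon>\<close> around 0, the excess of |z n|
  shrinks by a factor \<open>exp (- (\<delta> / n))\<close> per step, and the divergence of the
  harmonic series drives it to 0.\<close>

lemma perturbed_contraction_tendsto_0:
  fixes z c e :: "nat \<Rightarrow> real"
  assumes c: "c \<longlonglongrightarrow> \<gamma>" and \<gamma>: "\<gamma> > 0" and e: "e \<longlonglongrightarrow> 0"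
    and rec: "\<And>n. n \<ge> 1 \<Longrightarrow> z (Suc n) = (1 - c n / real n) * z n + e n / real n"
  shows "z \<longlonglongrightarrow> 0"
proof (rule LIMSEQ_I)
  fix \<epsilon>0 :: real assume "\<epsilon>0 > 0"
  define \<epsilon> where "\<epsilon> = \<epsilon>0 / 2"
  have \<epsilon>: "\<epsilon> > 0" using \<open>\<epsilon>0 > 0\<close> by (simp add: \<epsilon>_def)
  define \<delta> where "\<delta> = \<gamma> / 2"
  have \<delta>: "\<delta> > 0" using \<gamma> by (simp add: \<delta>_def)
  have "\<forall>\<^sub>F n in sequentially. c n > \<delta>"
    using order_tendstoD(1)[OF c, of \<delta>] \<gamma> by (simp add: \<delta>_def)
  moreover have "\<forall>\<^sub>F n in sequentially. c n < 2 * \<gamma>"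
    using order_tendstoD(2)[OF c, of "2 * \<gamma>"] \<gamma> by simp
  moreover have "\<forall>\<^sub>F n in sequentially. \<bar>e n\<bar> < \<delta> * \<epsilon>"
    using order_tendstoD(2)[OF tendsto_rabs[OF e], of "\<delta> * \<epsilon>"] \<delta> \<epsilon> by simp
  \<comment> \<open>Together with \<open>c n < 2 * \<gamma>\<close> this keeps the factor
    \<open>1 - c n / n\<close> nonnegative.\<close>
  moreover have "\<forall>\<^sub>F n in sequentially. real n > 2 * \<gamma>"
    using filterlim_real_sequentially by (simp add: filterlim_at_top_dense)
  ultimately have "\<forall>\<^sub>F n in sequentially.
      c n > \<delta> \<and> c n < 2 * \<gamma> \<and> \<bar>e n\<bar> < \<delta> * \<epsilon> \<and> real n > 2 * \<gamma>"
    by eventually_elim simp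
  then obtain N where N: "\<And>n. n \<ge> N \<Longrightarrow>
      c n > \<delta> \<and> c n < 2 * \<gamma> \<and> \<bar>e n\<bar> < \<delta> * \<epsilon> \<and> real n > 2 * \<gamma>"
    by (auto simp: eventually_sequentially)
  \<comment> \<open>Subtracting \<open>\<epsilon>\<close> absorbs the perturbation: (1 - \<delta>/n)
    |z n| + \<delta> \<epsilon>/n - \<epsilon> equals (1 - \<delta>/n) (|z n| - \<epsilon>).\<close>
  define y where "y n = max 0 (\<bar>z n\<bar> - \<epsilon>)" for n
  define h :: "nat \<Rightarrow> real" where "h n = (\<Sum>j\<in>{1..<n}. 1 / real j)" for n
  have ystep: "y (Suc n) \<le> exp (- (\<delta> / real n)) * y n" if "n \<ge> N" for n
  proof -
    note b = N[OF that]
    have "real n > 0" using b \<gamma> by linarith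
    then have n: "real n > 0" "n \<ge> 1" by auto
    have f1: "0 \<le> 1 - c n / real n" "1 - c n / real n \<le> 1 - \<delta> / real n"
      using b n by (auto simp: divide_simps)
    have "\<bar>z (Suc n)\<bar> \<le> \<bar>1 - c n / real n\<bar> * \<bar>z n\<bar> + \<bar>e n\<bar> / real n"
      using abs_triangle_ineq[of "(1 - c n / real n) * z n" "e n / real n"] n
      by (simp add: rec[OF n(2)] abs_mult)
    also have "\<dots> \<le> (1 - \<delta> / real n) * \<bar>z n\<bar> + \<delta> * \<epsilon> / real n"
      using f1 b n by (intro add_mono mult_mono divide_right_mono) auto
    finally have "\<bar>z (Suc n)\<bar> - \<epsilon> \<le> (1 - \<delta> / real n) * (\<bar>z n\<bar> - \<epsilon>)"
      by (simp add: algebra_simps)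
    also have "\<dots> \<le> (1 - \<delta> / real n) * y n"
      using f1 by (intro mult_left_mono) (auto simp: y_def)
    finally have "y (Suc n) \<le> (1 - \<delta> / real n) * y n"
      using f1 by (auto simp: y_def)
    also have "\<dots> \<le> exp (- (\<delta> / real n)) * y n"
      using exp_ge_add_one_self[of "- (\<delta> / real n)"] by (intro mult_right_mono) (auto simp: y_def)
    finally show ?thesis .
  qed
  have ybd: "y n \<le> y N * exp (\<delta> * h N) * exp (- (\<delta> * h n))" if "n \<ge> N" for n
    using that
  proof (induction n rule: dec_induct)
    case base
    show ?case by (simp add: mult.assoc flip: exp_add)
  next
    case (step n)
    have "n \<ge> 1" using N[OF step(1)] \<gamma> by (cases n) auto
    then have h: "h (Suc n) = h n + 1 / real n" by (simp add: h_def)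
    have "y (Suc n) \<le> exp (- (\<delta> / real n)) * (y N * exp (\<delta> * h N) * exp (- (\<delta> * h n)))"
      by (rule order.trans[OF ystep[OF step(1)]]) (intro mult_left_mono step(3), simp)
    also have "\<dots> = y N * exp (\<delta> * h N) * exp (- (\<delta> * h (Suc n)))"
      by (simp add: h distrib_left flip: exp_add)
    finally show ?case .
  qed
  have "filterlim h at_top sequentially"
  proof -
    have "(\<lambda>n. h (Suc n)) = harm"
      by (auto simp: h_def harm_def fun_eq_iff inverse_eq_divide atLeastLessThanSuc_atLeastAtMost)
    then show ?thesis using harm_at_top filterlim_sequentially_Suc[of h at_top] by simp
  qed
  then have "(\<lambda>n. exp (- (\<delta> * h n))) \<longlonglongrightarrow> 0"
    using \<delta> by (intro filterlim_compose[OF exp_at_bot])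
      (auto simp: filterlim_uminus_at_bot intro!: filterlim_tendsto_pos_mult_at_top)
  then have "(\<lambda>n. y N * exp (\<delta> * h N) * exp (- (\<delta> * h n))) \<longlonglongrightarrow> 0"
    using tendsto_mult_right_zero by blast
  then have "\<forall>\<^sub>F n in sequentially. y N * exp (\<delta> * h N) * exp (- (\<delta> * h n)) < \<epsilon>"
    using \<epsilon> by (rule order_tendstoD)
  then obtain M where M: "\<And>n. n \<ge> M \<Longrightarrow> y N * exp (\<delta> * h N) * exp (- (\<delta> * h n)) < \<epsilon>"
    by (auto simp: eventually_sequentially)
  have "norm (z n - 0) < \<epsilon>0" if "n \<ge> max M N" for n
    using M[of n] ybd[of n] that by (auto simp: y_def \<epsilon>_def)
  then show "\<exists>no. \<forall>n\<ge>no. norm (z n - 0) < \<epsilon>0" by blast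
qed

text \<open>With \<open>q = n / (n + 1)\<close>, the induction splits \<open>1 - q ^ (k + 1)\<close>
  into \<open>(1 - q ^ k) * q + (1 - q)\<close> and uses \<open>n * (1 - q) = q\<close>.\<close>

lemma ratio_power_defect_tendsto:
  "(\<lambda>n. real n * (1 - (real n / real (Suc n)) ^ k)) \<longlonglongrightarrow> real k"
proof (induction k)
  case (Suc k)
  have q: "(\<lambda>n. real n / real (Suc n)) \<longlonglongrightarrow> 1" by (rule LIMSEQ_n_over_Suc_n)
  have "(\<lambda>n. real n * (1 - (real n / real (Suc n)) ^ k) * (real n / real (Suc n)) + real n / real (Suc n))
      \<longlonglongrightarrow> real k * 1 + 1"
    by (intro tendsto_intros Suc q)
  moreover have "real n * (1 - (real n / real (Suc n)) ^ k) * (real n / real (Suc n)) + real n / real (Suc n)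
      = real n * (1 - (real n / real (Suc n)) ^ Suc k)" for n
  proof -
    have "real n / real (Suc n) = real n * (1 - real n / real (Suc n))" by (simp add: field_simps)
    then have "real n * (1 - (real n / real (Suc n)) ^ k) * (real n / real (Suc n)) + real n / real (Suc n)
      = real n * (1 - (real n / real (Suc n)) ^ k) * (real n / real (Suc n)) + real n * (1 - real n / real (Suc n))"
      by simp
    then show ?thesis by (simp add: algebra_simps)
  qed
  ultimately show ?case by (simp add: add.commute)
qed simp

text \<open>After division by \<open>n ^ (l + 1)\<close>, the deviation from the candidate limit
  obeys a perturbed contraction whose rate tends to \<open>l + 1 - A\<close>, which is positive by
  assumption.\<close>

lemma linear_recursion_asymptotics:
  fixes x \<alpha> \<beta> :: "nat \<Rightarrow> real"
  assumes rec: "\<And>n. n \<ge> 1 \<Longrightarrow> x (Suc n) = (1 + \<alpha> n) * x n + \<beta> n"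
    and \<alpha>: "(\<lambda>n. real n * \<alpha> n) \<longlonglongrightarrow> A"
    and \<beta>: "(\<lambda>n. \<beta> n / real n ^ l) \<longlonglongrightarrow> B"
    and A: "A < real (Suc l)"
  shows "(\<lambda>n. x n / real n ^ Suc l) \<longlonglongrightarrow> B / (real (Suc l) - A)"
proof -
  \<comment> \<open>The value for which the perturbation \<open>e n\<close> below vanishes in the
    limit, since \<open>B = (l + 1 - A) * L\<close>.\<close>
  define L where "L = B / (real (Suc l) - A)"
  define q where "q n = (real n / real (Suc n)) ^ Suc l" for n
  define c where "c n = real n * (1 - q n) - real n * \<alpha> n * q n" for n
  define e where "e n = \<beta> n / real n ^ l * q n - c n * L" for n
  define z where "z n = x n / real n ^ Suc l - L" for n
  have "(\<lambda>n. (real n / real (Suc n)) ^ Suc l) \<longlonglongrightarrow> 1 ^ Suc l"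
    by (intro tendsto_power LIMSEQ_n_over_Suc_n)
  then have q: "q \<longlonglongrightarrow> 1" by (simp add: q_def[abs_def])
  have c: "c \<longlonglongrightarrow> real (Suc l) - A * 1"
    unfolding c_def[abs_def]
    using ratio_power_defect_tendsto[of "Suc l"] \<alpha> q
    by (intro tendsto_diff tendsto_mult) (auto simp: q_def[abs_def])
  have "e \<longlonglongrightarrow> B * 1 - (real (Suc l) - A * 1) * L"
    unfolding e_def[abs_def] by (intro tendsto_intros c q \<beta>)
  also have "B * 1 - (real (Suc l) - A * 1) * L = 0" using A by (simp add: L_def)
  finally have e: "e \<longlonglongrightarrow> 0" .
  have "z (Suc n) = (1 - c n / real n) * z n + e n / real n" if n: "n \<ge> 1" for n
  proof -
    have n0: "real n \<noteq> 0" using n by simp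
    have c': "1 - c n / real n = (1 + \<alpha> n) * q n" using n0 by (simp add: c_def field_simps)
    have q': "x n / real (Suc n) ^ Suc l = q n * (x n / real n ^ Suc l)"
      "\<beta> n / real (Suc n) ^ Suc l = q n * (\<beta> n / real n ^ Suc l)"
      using n0 by (simp_all add: q_def power_divide)
    have "z (Suc n) = (1 + \<alpha> n) * (x n / real (Suc n) ^ Suc l) + \<beta> n / real (Suc n) ^ Suc l - L"
      unfolding z_def rec[OF n] by (simp add: add_divide_distrib)
    also have "\<dots> = (1 - c n / real n) * (x n / real n ^ Suc l) + q n * (\<beta> n / real n ^ Suc l) - L"
      by (simp only: q' c' mult_ac)
    also have "\<dots> = (1 - c n / real n) * z n + e n / real n"
      using n0 by (simp add: z_def e_def algebra_simps diff_divide_distrib)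
    finally show ?thesis .
  qed
  from perturbed_contraction_tendsto_0[OF c _ e this] A have "z \<longlonglongrightarrow> 0" by simp
  then have "(\<lambda>n. z n + L) \<longlonglongrightarrow> 0 + L" by (intro tendsto_intros)
  then show ?thesis by (simp add: z_def L_def)
qed

section \<open>Weights of the martingale increments\<close>

text \<open>The factor by which the projected position at time \<open>m\<close> enters its
  conditional mean at time \<open>n\<close>; each step contributes \<open>1 + a / j\<close>.\<close>

definition mem_prod :: "real \<Rightarrow> nat \<Rightarrow> nat \<Rightarrow> real" where
  "mem_prod a m n = (\<Prod>j\<in>{m..<n}. 1 + a / real j)"

text \<open>The coefficient \<open>b m n\<close> of the overview: the total effect of the noise of
  step \<open>m\<close> on the positions at times \<open>m\<close> to \<open>n\<close>.\<close>

definition mem_weight :: "real \<Rightarrow> nat \<Rightarrow> nat \<Rightarrow> real" where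
  "mem_weight a m n = (\<Sum>k\<in>{m..n}. mem_prod a m k)"

lemma mem_prod_refl [simp]: "mem_prod a n n = 1"
  by (simp add: mem_prod_def)

lemma mem_weight_refl [simp]: "mem_weight a n n = 1"
  by (simp add: mem_weight_def)

lemma mem_prod_Suc: "m \<le> n \<Longrightarrow> mem_prod a m (Suc n) = (1 + a / real n) * mem_prod a m n"
  by (simp add: mem_prod_def mult.commute)

lemma mem_weight_Suc: "m \<le> n \<Longrightarrow> mem_weight a m (Suc n) = mem_weight a m n + mem_prod a m (Suc n)"
  by (simp add: mem_weight_def)

text \<open>A recursion in the first index, obtained by splitting off the term \<open>k = m\<close>
  and one factor of each product. It is what makes the drift cancel in the martingale.\<close>

lemma mem_weight_rec:
  assumes "m < n"
  shows "mem_weight a m n = 1 + (1 + a / real m) * mem_weight a (Suc m) n"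
proof -
  have "mem_weight a m n = 1 + (\<Sum>k\<in>{Suc m..n}. mem_prod a m k)"
    using assms by (simp add: mem_weight_def sum.atLeast_Suc_atMost)
  also have "(\<Sum>k\<in>{Suc m..n}. mem_prod a m k) = (\<Sum>k\<in>{Suc m..n}. (1 + a / real m) * mem_prod a (Suc m) k)"
    by (intro sum.cong) (auto simp: mem_prod_def prod.atLeast_Suc_lessThan)
  finally show ?thesis by (simp add: mem_weight_def sum_distrib_left)
qed

text \<open>With \<open>v\<close> the variances of independent noises, the three sums are the second moments of
  the solution \<open>U\<close> of \<open>U (Suc n) = (1 + a / n) * U n + noise\<close> and of its partial sums, which
  is why they satisfy closed recursions in \<open>n\<close>.\<close>

lemma weighted_square_sum_asymptotics:
  fixes v :: "nat \<Rightarrow> real"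
  assumes v: "v \<longlonglongrightarrow> v0" and a: "a < 1 / 2"
  shows "(\<lambda>n. (\<Sum>m=1..n. v m * mem_weight a m n ^ 2) / real n ^ 3)
           \<longlonglongrightarrow> 2 * v0 / (3 * (1 - 2 * a) * (2 - a))"
    and "(\<lambda>n. (\<Sum>m=1..n. v m * mem_prod a m n ^ 2) / real n) \<longlonglongrightarrow> v0 / (1 - 2 * a)"
proof -
  \<comment> \<open>In terms of \<open>U\<close>: the variance of \<open>U n\<close>, its covariance
    with the partial sum, and the variance of the partial sum. They grow like \<open>n\<close>,
    \<open>n ^ 2\<close> and \<open>n ^ 3\<close>, and each recursion is driven by the preceding
    sums.\<close>
  define A where "A n = (\<Sum>m=1..n. v m * mem_prod a m n ^ 2)" for n
  define B where "B n = (\<Sum>m=1..n. v m * mem_prod a m n * mem_weight a m n)" for n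
  define D where "D n = (\<Sum>m=1..n. v m * mem_weight a m n ^ 2)" for n
  have A_rec: "A (Suc n) = (1 + (2 * a / real n + a\<^sup>2 / real n ^ 2)) * A n + v (Suc n)" for n
  proof -
    have "A (Suc n) = (\<Sum>m=1..n. v m * mem_prod a m (Suc n) ^ 2) + v (Suc n)"
      by (simp add: A_def)
    also have "(\<Sum>m=1..n. v m * mem_prod a m (Suc n) ^ 2) = (\<Sum>m=1..n. (1 + a / real n)\<^sup>2 * (v m * mem_prod a m n ^ 2))"
      by (intro sum.cong) (auto simp: mem_prod_Suc power_mult_distrib)
    also have "\<dots> = (1 + a / real n)\<^sup>2 * A n" by (simp add: A_def sum_distrib_left)
    finally show ?thesis by (simp add: power2_sum power_divide algebra_simps)
  qed
  have B_rec: "B (Suc n) = (1 + a / real n) * B n + A (Suc n)" for n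
  proof -
    have "B (Suc n) = (\<Sum>m=1..n. v m * mem_prod a m (Suc n) * mem_weight a m (Suc n)) + v (Suc n)"
      by (simp add: B_def)
    also have "(\<Sum>m=1..n. v m * mem_prod a m (Suc n) * mem_weight a m (Suc n))
      = (\<Sum>m=1..n. (1 + a / real n) * (v m * mem_prod a m n * mem_weight a m n) + v m * mem_prod a m (Suc n) ^ 2)"
      by (intro sum.cong) (auto simp: mem_weight_Suc power2_eq_square mem_prod_Suc algebra_simps)
    finally show ?thesis by (simp add: A_def B_def sum.distrib sum_distrib_left)
  qed
  have D_rec: "D (Suc n) = (1 + 0) * D n + (2 * (1 + a / real n) * B n + A (Suc n))" for n
  proof -
    have "D (Suc n) = (\<Sum>m=1..n. v m * mem_weight a m (Suc n) ^ 2) + v (Suc n)"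
      by (simp add: D_def)
    also have "(\<Sum>m=1..n. v m * mem_weight a m (Suc n) ^ 2)
      = (\<Sum>m=1..n. v m * mem_weight a m n ^ 2 + 2 * (1 + a / real n) * (v m * mem_prod a m n * mem_weight a m n)
           + v m * mem_prod a m (Suc n) ^ 2)"
      by (intro sum.cong) (auto simp: mem_weight_Suc power2_eq_square mem_prod_Suc algebra_simps)
    finally show ?thesis by (simp add: A_def B_def D_def sum.distrib sum_distrib_left)
  qed
  have "(\<lambda>n. 2 * a + a\<^sup>2 * (1 / real n)) \<longlonglongrightarrow> 2 * a + a\<^sup>2 * 0"
    by (intro tendsto_intros lim_1_over_n)
  then have "(\<lambda>n. 2 * a + a\<^sup>2 * (1 / real n)) \<longlonglongrightarrow> 2 * a" by simp
  then have "(\<lambda>n. real n * (2 * a / real n + a\<^sup>2 / real n ^ 2)) \<longlonglongrightarrow> 2 * a"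
    by (rule Lim_transform_eventually) (auto simp: eventually_sequentially field_simps power2_eq_square intro!: exI[of _ 1])
  \<comment> \<open>Here \<open>a < 1 / 2\<close> is essential: the growth exponent
    \<open>2 * a\<close> of the homogeneous part must stay below 1.\<close>
  from linear_recursion_asymptotics[OF A_rec this, of 0 v0]
  have A: "(\<lambda>n. A n / real n) \<longlonglongrightarrow> v0 / (1 - 2 * a)"
    using a v by (simp add: filterlim_sequentially_Suc)
  then show "(\<lambda>n. (\<Sum>m=1..n. v m * mem_prod a m n ^ 2) / real n) \<longlonglongrightarrow> v0 / (1 - 2 * a)"
    by (simp add: A_def)
  have Sn: "(\<lambda>n. real (Suc n) / real n) \<longlonglongrightarrow> 1" by (rule LIMSEQ_Suc_n_over_n)
  have "(\<lambda>n. A (Suc n) / real (Suc n)) \<longlonglongrightarrow> v0 / (1 - 2 * a)"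
    using LIMSEQ_Suc[OF A] .
  from tendsto_mult[OF this Sn] have A1: "(\<lambda>n. A (Suc n) / real n ^ 1) \<longlonglongrightarrow> v0 / (1 - 2 * a)"
    by (simp del: of_nat_Suc)
  have "(\<lambda>n. real n * (a / real n)) \<longlonglongrightarrow> a"
    by (rule Lim_transform_eventually[OF tendsto_const]) (auto simp: eventually_sequentially intro!: exI[of _ 1])
  from linear_recursion_asymptotics[OF B_rec this A1]
  have B: "(\<lambda>n. B n / real n ^ 2) \<longlonglongrightarrow> v0 / (1 - 2 * a) / (2 - a)"
    using a by (simp add: numeral_2_eq_2)
  have "(\<lambda>n. 2 * (1 + a * (1 / real n)) * (B n / real n ^ 2) + A (Suc n) / real n ^ 1 * (1 / real n))
     \<longlonglongrightarrow> 2 * (1 + a * 0) * (v0 / (1 - 2 * a) / (2 - a)) + v0 / (1 - 2 * a) * 0"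
    by (intro tendsto_intros lim_1_over_n A1 B)
  then have "(\<lambda>n. (2 * (1 + a / real n) * B n + A (Suc n)) / real n ^ 2) \<longlonglongrightarrow> 2 * (v0 / (1 - 2 * a) / (2 - a))"
    by (simp add: power2_eq_square add_divide_distrib)
  from linear_recursion_asymptotics[OF D_rec _ this, of 0]
  have "(\<lambda>n. D n / real n ^ 3) \<longlonglongrightarrow> 2 * (v0 / (1 - 2 * a) / (2 - a)) / 3"
    by (simp add: numeral_3_eq_3)
  then show "(\<lambda>n. (\<Sum>m=1..n. v m * mem_weight a m n ^ 2) / real n ^ 3)
           \<longlonglongrightarrow> 2 * v0 / (3 * (1 - 2 * a) * (2 - a))"
    unfolding D_def by (simp only: divide_divide_eq_left times_divide_eq_right mult_ac)
qed

text \<open>From \<open>-1 \<le> a\<close> each factor \<open>1 + a / j\<close> is nonnegative and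
  at most \<open>1 + b / j\<close>. The latter is at least 1, so extending the product to the full
  range only enlarges it. The bound is uniform in \<open>m\<close>.\<close>

lemma abs_mem_weight_le:
  assumes "-1 \<le> a" "a \<le> b" "0 \<le> b" "1 \<le> m" "m \<le> n"
  shows "\<bar>mem_weight a m n\<bar> \<le> real n * mem_prod b 1 n"
proof -
  have f: "\<bar>1 + a / real j\<bar> \<le> 1 + b / real j" if "j \<ge> 1" for j
  proof -
    have "- 1 * real j \<le> a" using that assms(1) by linarith
    then have "- 1 \<le> a / real j" using that by (simp add: le_divide_eq)
    moreover have "a / real j \<le> b / real j" using assms by (simp add: divide_right_mono)
    ultimately show ?thesis by linarith
  qed
  have "\<bar>mem_prod a m k\<bar> \<le> mem_prod b 1 n" if "k \<in> {m..n}" for k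
  proof -
    have "\<bar>mem_prod a m k\<bar> = (\<Prod>j\<in>{m..<k}. \<bar>1 + a / real j\<bar>)" by (simp add: mem_prod_def abs_prod)
    also have "\<dots> \<le> (\<Prod>j\<in>{m..<k}. 1 + b / real j)"
      using f assms by (intro prod_mono) auto
    also have "\<dots> \<le> (\<Prod>j\<in>{1..<n}. 1 + b / real j)"
      using that assms by (intro prod_mono2) auto
    finally show ?thesis by (simp add: mem_prod_def)
  qed
  then have "\<bar>mem_weight a m n\<bar> \<le> (\<Sum>k\<in>{m..n}. mem_prod b 1 n)"
    unfolding mem_weight_def by (intro order.trans[OF sum_abs] sum_mono) auto
  also have "\<dots> = real (card {m..n}) * mem_prod b 1 n" by simp
  also have "\<dots> \<le> real n * mem_prod b 1 n"
    using assms by (intro mult_right_mono) (auto simp: mem_prod_def intro!: prod_nonneg add_nonneg_nonneg)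
  finally show ?thesis .
qed

text \<open>The variance asymptotics are applied to noise concentrated at time 1: its variances tend
  to 0, and the weighted sum reduces to the single square of \<open>mem_prod b 1 n\<close>.\<close>

lemma mem_prod_over_sqrt_tendsto_0:
  assumes b: "b < 1 / 2"
  shows "(\<lambda>n. mem_prod b 1 n / sqrt (real n)) \<longlonglongrightarrow> 0"
proof -
  define v :: "nat \<Rightarrow> real" where "v m = (if m = 1 then 1 else 0)" for m
  have "v \<longlonglongrightarrow> 0"
    by (rule tendsto_eventually) (auto simp: v_def eventually_sequentially intro!: exI[of _ 2])
  from weighted_square_sum_asymptotics(2)[OF this b]
  have "(\<lambda>n. (\<Sum>m=1..n. v m * mem_prod b m n ^ 2) / real n) \<longlonglongrightarrow> 0" by simp
  moreover have "(\<Sum>m=1..n. v m * mem_prod b m n ^ 2) = mem_prod b 1 n ^ 2" if "n \<ge> 1" for n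
  proof -
    have "(\<Sum>m=1..n. v m * mem_prod b m n ^ 2) = (\<Sum>m=1..n. if m = 1 then mem_prod b m n ^ 2 else 0)"
      by (intro sum.cong) (auto simp: v_def)
    then show ?thesis using that by simp
  qed
  then have "\<forall>\<^sub>F n in sequentially. (\<Sum>m=1..n. v m * mem_prod b m n ^ 2) / real n = (mem_prod b 1 n / sqrt (real n)) ^ 2"
    by (auto simp: eventually_sequentially power_divide intro!: exI[of _ 1])
  ultimately have "(\<lambda>n. (mem_prod b 1 n / sqrt (real n)) ^ 2) \<longlonglongrightarrow> 0"
    by (rule Lim_transform_eventually)
  then show ?thesis by (simp add: power_tendsto_0_iff)
qed

section \<open>Conditional expectations and second moments of the walk\<close>

lemma expectation_bind_pmf_finite:
  fixes h :: "'b \<Rightarrow> 'c::{banach, second_countable_topology}"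
  assumes "finite (set_pmf M)" "\<And>x. finite (set_pmf (f x))"
  shows "measure_pmf.expectation (M \<bind> f) h = measure_pmf.expectation M (\<lambda>x. measure_pmf.expectation (f x) h)"
  using assms by (simp add: pmf_expectation_bind[of "set_pmf M"] integral_measure_pmf[of "set_pmf M"])

lemma finite_set_erw_steps [simp]: "finite (set_pmf (erw_steps p n))"
  by (induction n) auto

lemma length_erw_steps: "xs \<in> set_pmf (erw_steps p n) \<Longrightarrow> length xs = n"
  by (induction n arbitrary: xs) auto

lemma integrable_erw_steps [simp]:
  fixes f :: "_ \<Rightarrow> 'c::{banach, second_countable_topology}"
  shows "integrable (measure_pmf (erw_steps p n)) f"
  by (intro integrable_measure_pmf_finite) simp

lemma integrable_finite_type [simp]:
  fixes f :: "'a::finite \<Rightarrow> 'c::{banach, second_countable_topology}"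
  shows "integrable (measure_pmf M) f"
  by (intro integrable_measure_pmf_finite) simp

lemma expectation_erw_steps_Suc:
  fixes h :: "('d::finite \<times> bool) list \<Rightarrow> 'c::{banach, second_countable_topology}"
  shows "measure_pmf.expectation (erw_steps p (Suc n)) h =
    measure_pmf.expectation (erw_steps p n) (\<lambda>xs. measure_pmf.expectation (erw_next p xs) (\<lambda>x. h (xs @ [x])))"
  by (simp add: expectation_bind_pmf_finite)

lemma expectation_pmf_of_set:
  fixes f :: "'a \<Rightarrow> real"
  assumes "finite A" "A \<noteq> {}"
  shows "measure_pmf.expectation (pmf_of_set A) f = sum f A / real (card A)"
  using assms by (rule integral_pmf_of_set[rotated])

lemma expectation_erw_steps_mono:
  fixes f g :: "('d::finite \<times> bool) list \<Rightarrow> real"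
  assumes "\<And>xs. length xs = n \<Longrightarrow> f xs \<le> g xs"
  shows "measure_pmf.expectation (erw_steps p n) f \<le> measure_pmf.expectation (erw_steps p n) g"
  using assms by (intro integral_mono_AE) (auto simp: AE_measure_pmf_iff length_erw_steps)

lemma expectation_erw_steps_cong:
  fixes f g :: "('d::finite \<times> bool) list \<Rightarrow> 'c::{banach, second_countable_topology}"
  assumes "\<And>xs. length xs = n \<Longrightarrow> f xs = g xs"
  shows "measure_pmf.expectation (erw_steps p n) f = measure_pmf.expectation (erw_steps p n) g"
  using assms by (intro integral_cong_AE) (auto simp: AE_measure_pmf_iff length_erw_steps)

lemma sum_nth_append_less: "k \<le> length xs \<Longrightarrow> (\<Sum>j<k. g ((xs @ [x]) ! j)) = (\<Sum>j<k. g (xs ! j))"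
  by (intro sum.cong) (auto simp: nth_append)

text \<open>The assumption \<open>a_less\<close> is the diffusive condition \<open>p < p_d\<close>
  expressed through \<open>a\<close>.\<close>

locale elephant =
  fixes p a :: real and dims :: "'d::finite itself"
  assumes p_ge_0: "0 \<le> p" and p_le_1: "p \<le> 1"
    and a_eq: "a = (2 * real CARD('d) * p - 1) / (2 * real CARD('d) - 1)"
    and a_less: "a < 1 / 2"
begin

lemma card_ge_1: "real CARD('d) \<ge> 1"
proof -
  have "CARD('d) \<ge> 1" by (simp add: Suc_leI)
  then show ?thesis by linarith
qed

lemma a_ge: "-1 \<le> a"
proof -
  define D where "D = real CARD('d)"
  have D: "D \<ge> 1" using card_ge_1 by (simp add: D_def)
  then have "D * p \<ge> 0" using p_ge_0 by simp
  then have "- 1 * (2 * D - 1) \<le> 2 * D * p - 1" using D by (simp add: algebra_simps)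
  then show ?thesis using D unfolding a_eq D_def[symmetric] by (simp add: le_divide_eq)
qed

lemma abs_a_le: "\<bar>a\<bar> \<le> 1"
  using a_ge a_less by linarith

text \<open>The next step follows a combination, signed if \<open>a < 0\<close>, of the empirical
  law of the past with weight \<open>a\<close> and the uniform law with weight
  \<open>1 - a\<close>.\<close>

lemma expectation_erw_next:
  fixes f :: "'d \<times> bool \<Rightarrow> real"
  assumes "xs \<noteq> []"
  shows "measure_pmf.expectation (erw_next p xs) f =
    a * (\<Sum>j<length xs. f (xs ! j)) / real (length xs) + (1 - a) * (\<Sum>x\<in>UNIV. f x) / (2 * real CARD('d))"
proof -
  define D where "D = real CARD('d)"
  have D: "D \<ge> 1" using card_ge_1 by (simp add: D_def)
  have cU: "real (card (UNIV - {y :: 'd \<times> bool})) = 2 * D - 1" for y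
  proof -
    have "card (UNIV - {y :: 'd \<times> bool}) = 2 * CARD('d) - 1" by (simp add: card_Diff_singleton)
    then show ?thesis using D unfolding D_def by (simp add: of_nat_diff Suc_leI)
  qed
  have ne: "UNIV - {y :: 'd \<times> bool} \<noteq> {}" for y
  proof
    assume "UNIV - {y} = {}"
    then have "real (card (UNIV - {y})) = 0" by (simp only: card.empty of_nat_0)
    then show False using cU[of y] D by linarith
  qed
  have rest: "measure_pmf.expectation (pmf_of_set (UNIV - {y})) f = (sum f UNIV - f y) / (2 * D - 1)" for y
    using expectation_pmf_of_set[OF finite ne, of y f] by (simp only: cU sum_diff1 finite UNIV_I if_True)
  have one: "measure_pmf.expectation (bernoulli_pmf p \<bind> (\<lambda>b. if b then return_pmf y else pmf_of_set (UNIV - {y}))) f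
     = a * f y + (1 - a) / (2 * D) * sum f UNIV" for y
  proof -
    \<comment> \<open>The probability of each direction other than \<open>y\<close>. Giving this
      mass to all \<open>2 * D\<close> directions leaves \<open>p - c = a\<close> on
      \<open>y\<close> itself.\<close>
    define c where "c = (1 - p) / (2 * D - 1)"
    have "measure_pmf.expectation (bernoulli_pmf p \<bind> (\<lambda>b. if b then return_pmf y else pmf_of_set (UNIV - {y}))) f
      = f y * p + (sum f UNIV - f y) / (2 * D - 1) * (1 - p)"
      using p_ge_0 p_le_1 by (subst expectation_bind_pmf_finite) (auto simp: rest)
    also have "\<dots> = (p - c) * f y + c * sum f UNIV"
      by (simp add: c_def algebra_simps diff_divide_distrib)
    also have "p - c = a" using D by (simp add: c_def a_eq D_def[symmetric] field_simps)
    also have "c = (1 - a) / (2 * D)" using D by (simp add: c_def a_eq D_def[symmetric] field_simps)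
    finally show ?thesis .
  qed
  have "measure_pmf.expectation (erw_next p xs) f =
    measure_pmf.expectation (pmf_of_set {0..<length xs}) (\<lambda>k. a * f (xs ! k) + (1 - a) / (2 * D) * sum f UNIV)"
    unfolding erw_next_def using assms by (simp add: expectation_bind_pmf_finite one del: bind_return_pmf)
  also have "\<dots> = (\<Sum>k\<in>{0..<length xs}. a * f (xs ! k) + (1 - a) / (2 * D) * sum f UNIV) / real (length xs)"
    using assms by (subst expectation_pmf_of_set) auto
  also have "\<dots> = a * (\<Sum>j<length xs. f (xs ! j)) / real (length xs) + (1 - a) * sum f UNIV / (2 * D)"
    using assms by (simp add: sum.distrib add_divide_distrib atLeast0LessThan flip: sum_distrib_left)
  finally show ?thesis by (simp add: D_def)
qed

text \<open>For centered \<open>f\<close> the uniform part drops out. The empty history is covered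
  too: the first step is uniform, and division by zero gives 0 on the right. It serves both the
  projection and its centered square.\<close>

lemma expectation_erw_next_mean_zero:
  fixes f :: "'d \<times> bool \<Rightarrow> real"
  assumes "(\<Sum>x\<in>UNIV. f x) = 0"
  shows "measure_pmf.expectation (erw_next p xs) f = a * (\<Sum>j<length xs. f (xs ! j)) / real (length xs)"
proof (cases "xs = []")
  case True
  then show ?thesis using assms by (simp add: erw_next_def expectation_pmf_of_set)
next
  case False
  then show ?thesis using assms by (simp add: expectation_erw_next)
qed

section \<open>Second moment bounds\<close>

definition second_moment_const :: real where
  "second_moment_const = 1 / (1 - 2 * max a 0)"

lemma second_moment_const_ge_0: "second_moment_const \<ge> 0"
  using a_less by (simp add: second_moment_const_def)

text \<open>Expanding the square of the new sum, the cross term contributes \<open>2 * a / n\<close>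
  times the old square. The constant solves \<open>C * (1 - 2 * b) = 1\<close> with
  \<open>b = max a 0\<close>, which is what lets the linear bound reproduce itself in the
  induction.\<close>

lemma second_moment_bound:
  fixes g :: "'d \<times> bool \<Rightarrow> real"
  assumes g0: "(\<Sum>x\<in>UNIV. g x) = 0" and gK: "\<And>x. \<bar>g x\<bar> \<le> K"
  shows "measure_pmf.expectation (erw_steps p n) (\<lambda>xs. (\<Sum>j<n. g (xs ! j))\<^sup>2) \<le> K\<^sup>2 * second_moment_const * real n"
proof (induction n)
  case (Suc n)
  \<comment> \<open>Replacing \<open>a\<close> by its positive part keeps
    \<open>1 + 2 * b / n\<close> nonnegative, so that the induction hypothesis may be multiplied by
    it.\<close>
  define b where "b = max a 0"
  have b: "a \<le> b" "0 \<le> b" "b < 1 / 2" using a_less by (auto simp: b_def)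
  have C: "second_moment_const * (1 - 2 * b) = 1" using b by (simp add: second_moment_const_def b_def)
  have step: "measure_pmf.expectation (erw_next p xs) (\<lambda>x. (\<Sum>j<Suc n. g ((xs @ [x]) ! j))\<^sup>2)
      \<le> (1 + 2 * b / real n) * (\<Sum>j<n. g (xs ! j))\<^sup>2 + K\<^sup>2" if "length xs = n" for xs
  proof -
    define S where "S = (\<Sum>j<n. g (xs ! j))"
    have "(\<Sum>j<Suc n. g ((xs @ [x]) ! j))\<^sup>2 = S\<^sup>2 + (2 * S) * g x + (g x)\<^sup>2" for x
      using that by (simp add: S_def sum_nth_append_less power2_sum nth_append)
    then have "measure_pmf.expectation (erw_next p xs) (\<lambda>x. (\<Sum>j<Suc n. g ((xs @ [x]) ! j))\<^sup>2)
      = S\<^sup>2 + (2 * S) * (a * S / real n) + measure_pmf.expectation (erw_next p xs) (\<lambda>x. (g x)\<^sup>2)"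
      using that by (simp add: expectation_erw_next_mean_zero[OF g0] S_def)
    also have "measure_pmf.expectation (erw_next p xs) (\<lambda>x. (g x)\<^sup>2) \<le> measure_pmf.expectation (erw_next p xs) (\<lambda>x. K\<^sup>2)"
      using gK by (intro integral_mono) (auto simp: abs_le_square_iff[symmetric] intro: order.trans[OF _ abs_ge_self])
    also have "(2 * S) * (a * S / real n) \<le> 2 * b / real n * S\<^sup>2"
    proof -
      have "(2 * S) * (a * S / real n) = 2 * a / real n * S\<^sup>2" by (simp add: power2_eq_square)
      also have "\<dots> \<le> 2 * b / real n * S\<^sup>2" using b by (intro mult_right_mono divide_right_mono) auto
      finally show ?thesis .
    qed
    finally show ?thesis by (simp add: S_def algebra_simps)
  qed
  have "measure_pmf.expectation (erw_steps p (Suc n)) (\<lambda>xs. (\<Sum>j<Suc n. g (xs ! j))\<^sup>2)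
     \<le> measure_pmf.expectation (erw_steps p n) (\<lambda>xs. (1 + 2 * b / real n) * (\<Sum>j<n. g (xs ! j))\<^sup>2 + K\<^sup>2)"
    unfolding expectation_erw_steps_Suc by (intro expectation_erw_steps_mono step)
  also have "\<dots> = (1 + 2 * b / real n) * measure_pmf.expectation (erw_steps p n) (\<lambda>xs. (\<Sum>j<n. g (xs ! j))\<^sup>2) + K\<^sup>2"
    by simp
  also have "\<dots> \<le> (1 + 2 * b / real n) * (K\<^sup>2 * second_moment_const * real n) + K\<^sup>2"
    using b Suc by (intro add_right_mono mult_left_mono) auto
  \<comment> \<open>For \<open>n = 0\<close> the term with \<open>2 * b / n\<close> is 0, so only an
    inequality holds here in general.\<close>
  also have "\<dots> \<le> K\<^sup>2 * second_moment_const * real n + 2 * b * (K\<^sup>2 * second_moment_const) + K\<^sup>2"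
    using b second_moment_const_ge_0 by (cases "n = 0") (auto simp: algebra_simps)
  also have "\<dots> = K\<^sup>2 * second_moment_const * real n + K\<^sup>2 * (second_moment_const * (1 - 2 * b) + 2 * b * second_moment_const)"
    unfolding C by (simp add: algebra_simps)
  also have "\<dots> = K\<^sup>2 * second_moment_const * real (Suc n)"
    by (simp add: algebra_simps)
  finally show ?case .
qed simp

lemma second_moment_bound_prefix:
  fixes g :: "'d \<times> bool \<Rightarrow> real"
  assumes "(\<Sum>x\<in>UNIV. g x) = 0" "\<And>x. \<bar>g x\<bar> \<le> K" "k \<le> n"
  shows "measure_pmf.expectation (erw_steps p n) (\<lambda>xs. (\<Sum>j<k. g (xs ! j))\<^sup>2) \<le> K\<^sup>2 * second_moment_const * real k"
  using assms(3)
proof (induction n rule: dec_induct)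
  case base
  show ?case using assms by (intro second_moment_bound)
next
  case (step n)
  have "measure_pmf.expectation (erw_steps p (Suc n)) (\<lambda>xs. (\<Sum>j<k. g (xs ! j))\<^sup>2)
    = measure_pmf.expectation (erw_steps p n) (\<lambda>xs. (\<Sum>j<k. g (xs ! j))\<^sup>2)"
    unfolding expectation_erw_steps_Suc using step(1)
    by (intro expectation_erw_steps_cong) (simp add: sum_nth_append_less)
  then show ?case using step by simp
qed

text \<open>Cauchy-Schwarz over the \<open>n\<close> partial sums reduces this to the bound for
  prefixes. The order \<open>n ^ 3\<close> is the one removed by the scaling of the center, so this
  yields tightness.\<close>

lemma center_second_moment_bound:
  fixes g :: "'d \<times> bool \<Rightarrow> real"
  assumes "(\<Sum>x\<in>UNIV. g x) = 0" "\<And>x. \<bar>g x\<bar> \<le> K"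
  shows "measure_pmf.expectation (erw_steps p n) (\<lambda>xs. (\<Sum>k=1..n. \<Sum>j<k. g (xs ! j))\<^sup>2)
     \<le> K\<^sup>2 * second_moment_const * real n ^ 3"
proof -
  have "measure_pmf.expectation (erw_steps p n) (\<lambda>xs. (\<Sum>k=1..n. \<Sum>j<k. g (xs ! j))\<^sup>2)
    \<le> measure_pmf.expectation (erw_steps p n) (\<lambda>xs. real n * (\<Sum>k=1..n. (\<Sum>j<k. g (xs ! j))\<^sup>2))"
    using sum_squared_le_sum_of_squares[of _ "{1..n}"]
    by (intro expectation_erw_steps_mono) (auto simp: mult.commute)
  also have "\<dots> = real n * (\<Sum>k=1..n. measure_pmf.expectation (erw_steps p n) (\<lambda>xs. (\<Sum>j<k. g (xs ! j))\<^sup>2))"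
    by simp
  also have "\<dots> \<le> real n * (\<Sum>k=1..n. K\<^sup>2 * second_moment_const * real n)"
  proof (intro mult_left_mono sum_mono)
    fix k assume k: "k \<in> {1..n}"
    have "measure_pmf.expectation (erw_steps p n) (\<lambda>xs. (\<Sum>j<k. g (xs ! j))\<^sup>2) \<le> K\<^sup>2 * second_moment_const * real k"
      using k assms by (intro second_moment_bound_prefix) auto
    also have "\<dots> \<le> K\<^sup>2 * second_moment_const * real n"
      using k second_moment_const_ge_0 by (intro mult_left_mono) auto
    finally show "measure_pmf.expectation (erw_steps p n) (\<lambda>xs. (\<Sum>j<k. g (xs ! j))\<^sup>2) \<le> \<dots>" .
  qed auto
  finally show ?thesis by (simp add: power3_eq_cube mult_ac)
qed

end

section \<open>Characteristic functions of the projected center\<close>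

text \<open>The upper estimate rests on
  \<open>(1 - y + y^2 / 2) * (1 + y + y^2 / 2) = 1 + y^4 / 4\<close> and the quadratic lower bound
  for \<open>exp y\<close>.\<close>

lemma exp_minus_quadratic_bound:
  fixes y :: real
  assumes "y \<ge> 0"
  shows "\<bar>exp (- y) - (1 - y)\<bar> \<le> y\<^sup>2 / 2"
proof -
  have "1 \<le> (1 - y + y\<^sup>2 / 2) * (1 + y + y\<^sup>2 / 2)"
    using assms by (simp add: algebra_simps power2_eq_square)
  also have "\<dots> \<le> (1 - y + y\<^sup>2 / 2) * exp y"
  proof (intro mult_left_mono exp_lower_Taylor_quadratic assms)
    have "0 \<le> (1 - y)\<^sup>2 + 1" by (simp add: add_nonneg_nonneg)
    then show "0 \<le> 1 - y + y\<^sup>2 / 2" by (simp add: power2_diff)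
  qed
  finally have "exp (- y) \<le> 1 - y + y\<^sup>2 / 2"
    by (simp add: exp_minus field_simps)
  moreover have "1 - y \<le> exp (- y)" using exp_ge_add_one_self[of "- y"] by simp
  ultimately show ?thesis by simp
qed

text \<open>Second order Taylor expansion, with the linear term killed by the zero mean. Here
  \<open>s\<close> is a target variance; the three errors come from the variance mismatch, the cubic
  remainder, and replacing \<open>1 - \<theta>^2 * s / 2\<close> by an exponential.\<close>

lemma char_centered_quadratic_bound:
  fixes N :: "'a pmf" and \<epsilon> :: "'a \<Rightarrow> real" and \<theta> s K :: real
  assumes fin: "finite (set_pmf N)" and K: "\<And>x. \<bar>\<epsilon> x\<bar> \<le> K" and s: "s \<ge> 0"
    and mean: "measure_pmf.expectation N \<epsilon> = 0"
  shows "norm (measure_pmf.expectation N (\<lambda>x. iexp (\<theta> * \<epsilon> x)) - exp (- (\<theta>\<^sup>2 * s / 2)))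
    \<le> \<theta>\<^sup>2 / 2 * \<bar>measure_pmf.expectation N (\<lambda>x. (\<epsilon> x)\<^sup>2) - s\<bar> + K ^ 3 / 6 * \<bar>\<theta>\<bar> ^ 3 + s\<^sup>2 / 8 * \<theta> ^ 4"
proof -
  define \<sigma> where "\<sigma> = measure_pmf.expectation N (\<lambda>x. (\<epsilon> x)\<^sup>2)"
  have [simp]: "integrable (measure_pmf N) f" for f :: "'a \<Rightarrow> 'c::{banach, second_countable_topology}"
    using fin by (rule integrable_measure_pmf_finite)
  define P where "P x = (1 + \<i> * complex_of_real \<theta> * complex_of_real (\<epsilon> x)) - complex_of_real (\<theta>\<^sup>2 / 2) * complex_of_real ((\<epsilon> x)\<^sup>2)" for x
  have P: "measure_pmf.expectation N P = complex_of_real (1 - \<theta>\<^sup>2 * \<sigma> / 2)"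
    unfolding P_def by (simp add: \<sigma>_def mean del: of_real_power)
  have approx: "norm (iexp (\<theta> * \<epsilon> x) - P x) \<le> K ^ 3 / 6 * \<bar>\<theta>\<bar> ^ 3" for x
  proof -
    have "(\<Sum>k\<le>2. (\<i> * complex_of_real (\<theta> * \<epsilon> x)) ^ k / fact k) = P x"
      by (simp add: P_def numeral_2_eq_2 power_mult_distrib algebra_simps fact_numeral)
    then have "norm (iexp (\<theta> * \<epsilon> x) - P x) \<le> \<bar>\<theta> * \<epsilon> x\<bar> ^ 3 / 6"
      using iexp_approx1[of "\<theta> * \<epsilon> x" 2] by (simp add: numeral_eq_Suc)
    also have "\<dots> = \<bar>\<theta>\<bar> ^ 3 * \<bar>\<epsilon> x\<bar> ^ 3 / 6" by (simp add: abs_mult power_mult_distrib)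
    also have "\<dots> \<le> \<bar>\<theta>\<bar> ^ 3 * K ^ 3 / 6"
      using K by (intro divide_right_mono mult_left_mono power_mono) auto
    finally show ?thesis by (simp add: mult_ac)
  qed
  have "norm (measure_pmf.expectation N (\<lambda>x. iexp (\<theta> * \<epsilon> x)) - measure_pmf.expectation N P)
    = norm (measure_pmf.expectation N (\<lambda>x. iexp (\<theta> * \<epsilon> x) - P x))"
    by simp
  also have "\<dots> \<le> measure_pmf.expectation N (\<lambda>x. norm (iexp (\<theta> * \<epsilon> x) - P x))"
    by (rule integral_norm_bound)
  also have "\<dots> \<le> measure_pmf.expectation N (\<lambda>x. K ^ 3 / 6 * \<bar>\<theta>\<bar> ^ 3)"
    by (intro integral_mono approx) auto
  finally have 1: "norm (measure_pmf.expectation N (\<lambda>x. iexp (\<theta> * \<epsilon> x)) - complex_of_real (1 - \<theta>\<^sup>2 * \<sigma> / 2))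
    \<le> K ^ 3 / 6 * \<bar>\<theta>\<bar> ^ 3" by (simp add: P)
  have "\<bar>(1 - \<theta>\<^sup>2 * \<sigma> / 2) - exp (- (\<theta>\<^sup>2 * s / 2))\<bar>
     \<le> \<bar>exp (- (\<theta>\<^sup>2 * s / 2)) - (1 - \<theta>\<^sup>2 * s / 2)\<bar> + \<bar>\<theta>\<^sup>2 / 2 * (\<sigma> - s)\<bar>"
    using abs_triangle_ineq4[of "(1 - \<theta>\<^sup>2 * s / 2) - exp (- (\<theta>\<^sup>2 * s / 2))" "\<theta>\<^sup>2 / 2 * (\<sigma> - s)"]
    by (simp add: right_diff_distrib abs_minus_commute)
  also have "\<dots> \<le> (\<theta>\<^sup>2 * s / 2)\<^sup>2 / 2 + \<theta>\<^sup>2 / 2 * \<bar>\<sigma> - s\<bar>"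
    using s by (intro add_mono exp_minus_quadratic_bound) (auto simp: abs_mult)
  also have "(\<theta>\<^sup>2 * s / 2)\<^sup>2 / 2 = s\<^sup>2 / 8 * \<theta> ^ 4"
    by (simp add: power_mult_distrib power_divide)
  finally have "norm (complex_of_real (1 - \<theta>\<^sup>2 * \<sigma> / 2) - complex_of_real (exp (- (\<theta>\<^sup>2 * s / 2))))
     \<le> s\<^sup>2 / 8 * \<theta> ^ 4 + \<theta>\<^sup>2 / 2 * \<bar>\<sigma> - s\<bar>"
    by (simp only: norm_of_real flip: of_real_diff)
  from norm_triangle_mono[OF 1 this] show ?thesis by (simp add: \<sigma>_def)
qed

section \<open>The martingale of the projected walk\<close>

context elephant
begin

text \<open>In the application \<open>w\<close> is the inner product of a direction with a fixed
  \<open>u\<close>, and \<open>K\<close> is the norm of \<open>u\<close>. The number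
  \<open>s\<close> is the variance of \<open>w\<close> under the uniform law.\<close>

context
  fixes w :: "'d \<times> bool \<Rightarrow> real" and K s :: real
  assumes w_mean: "(\<Sum>x\<in>UNIV. w x) = 0" and w_bound: "\<And>x. \<bar>w x\<bar> \<le> K"
    and s_eq: "s = (\<Sum>x\<in>UNIV. (w x)\<^sup>2) / (2 * real CARD('d))"
begin

definition proj_pos :: "('d \<times> bool) list \<Rightarrow> nat \<Rightarrow> real" where
  "proj_pos xs k = (\<Sum>j<k. w (xs ! j))"

text \<open>The martingale difference: the projected step minus its conditional mean. For empty
  \<open>xs\<close> the subtracted quotient is 0, in agreement with the uniform first step.\<close>

definition innovation :: "('d \<times> bool) list \<Rightarrow> 'd \<times> bool \<Rightarrow> real" where
  "innovation xs x = w x - a * proj_pos xs (length xs) / real (length xs)"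

text \<open>The conditional expectation of the sum of the first \<open>n\<close> projected positions given the
  first \<open>m\<close> steps.\<close>

definition center_mart :: "nat \<Rightarrow> nat \<Rightarrow> ('d \<times> bool) list \<Rightarrow> real" where
  "center_mart n m xs = (\<Sum>k=1..m. proj_pos xs k) + (mem_weight a m n - 1) * proj_pos xs m"

definition variance_defect :: "nat \<Rightarrow> real" where
  "variance_defect m = measure_pmf.expectation (erw_steps p m)
     (\<lambda>xs. \<bar>measure_pmf.expectation (erw_next p xs) (\<lambda>x. (innovation xs x)\<^sup>2) - s\<bar>)"

lemma s_ge_0: "s \<ge> 0"
  by (simp add: s_eq sum_nonneg)

lemma K_ge_0: "K \<ge> 0"
  using w_bound[of undefined] by linarith

lemma proj_pos_append: "k \<le> length xs \<Longrightarrow> proj_pos (xs @ [x]) k = proj_pos xs k"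
  by (simp add: proj_pos_def sum_nth_append_less)

lemma proj_pos_append_Suc: "proj_pos (xs @ [x]) (Suc (length xs)) = proj_pos xs (length xs) + w x"
  using proj_pos_append[of "length xs" xs x] by (simp add: proj_pos_def)

text \<open>By \<open>mem_weight_rec\<close> the old coefficient of the current position already
  contains the drift \<open>1 + a / m\<close>, so only the innovation is left.\<close>

lemma center_mart_step:
  assumes "length xs = m" "m < n"
  shows "center_mart n (Suc m) (xs @ [x]) = center_mart n m xs + mem_weight a (Suc m) n * innovation xs x"
proof -
  have "(\<Sum>k=1..m. proj_pos (xs @ [x]) k) = (\<Sum>k=1..m. proj_pos xs k)"
    using assms by (intro sum.cong) (auto simp: proj_pos_append)
  then have "center_mart n (Suc m) (xs @ [x]) = (\<Sum>k=1..m. proj_pos xs k) + mem_weight a (Suc m) n * (proj_pos xs m + w x)"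
    using assms proj_pos_append_Suc[of xs x] by (simp add: center_mart_def algebra_simps)
  then show ?thesis
    using mem_weight_rec[OF assms(2), of a] assms
    by (simp add: center_mart_def innovation_def algebra_simps)
qed

lemma abs_innovation_le: "\<bar>innovation xs x\<bar> \<le> 2 * K"
proof -
  have "\<bar>proj_pos xs (length xs)\<bar> \<le> (\<Sum>j<length xs. K)"
    unfolding proj_pos_def by (intro order.trans[OF sum_abs] sum_mono w_bound)
  then have "\<bar>a\<bar> * \<bar>proj_pos xs (length xs)\<bar> \<le> 1 * (real (length xs) * K)"
    using abs_a_le by (intro mult_mono) auto
  then have "\<bar>a * proj_pos xs (length xs) / real (length xs)\<bar> \<le> K"
    using K_ge_0 by (cases "xs = []") (auto simp: abs_mult divide_le_eq mult.commute)
  then show ?thesis using w_bound[of x] unfolding innovation_def by linarith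
qed

lemma innovation_mean: "measure_pmf.expectation (erw_next p xs) (innovation xs) = 0"
  unfolding innovation_def[abs_def]
  by (simp add: expectation_erw_next_mean_zero[OF w_mean] proj_pos_def)

text \<open>The centered square of \<open>w\<close> has conditional mean \<open>a\<close> times its
  empirical mean; subtracting the squared conditional mean of \<open>w\<close> gives the
  variance.\<close>

lemma innovation_variance:
  "measure_pmf.expectation (erw_next p xs) (\<lambda>x. (innovation xs x)\<^sup>2) - s =
     a * (\<Sum>j<length xs. (w (xs ! j))\<^sup>2 - s) / real (length xs)
     - (a * proj_pos xs (length xs) / real (length xs))\<^sup>2"
proof -
  define t where "t = a * proj_pos xs (length xs) / real (length xs)"
  have "(\<Sum>x\<in>UNIV. (w x)\<^sup>2 - s) = 0"
    using card_ge_1 by (simp add: sum_subtractf s_eq)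
  note z = expectation_erw_next_mean_zero[OF this, of xs]
  have "(innovation xs x)\<^sup>2 = ((w x)\<^sup>2 - s) + s - 2 * t * w x + t\<^sup>2" for x
    by (simp add: innovation_def t_def power2_diff)
  then have "measure_pmf.expectation (erw_next p xs) (\<lambda>x. (innovation xs x)\<^sup>2) =
    measure_pmf.expectation (erw_next p xs) (\<lambda>x. (w x)\<^sup>2 - s) + s - 2 * t * measure_pmf.expectation (erw_next p xs) w + t\<^sup>2"
    by simp
  also have "measure_pmf.expectation (erw_next p xs) w = t"
    by (simp add: expectation_erw_next_mean_zero[OF w_mean] t_def proj_pos_def)
  finally show ?thesis unfolding z by (simp add: t_def power2_eq_square)
qed

text \<open>The second moment bound is used twice: for the centered square of \<open>w\<close>,
  whose empirical mean is of order \<open>1 / sqrt m\<close> in mean, and for \<open>w\<close>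
  itself, whose squared empirical mean is of order \<open>1 / m\<close>.\<close>

lemma variance_defect_tendsto_0: "variance_defect \<longlonglongrightarrow> 0"
proof -
  define K2 where "K2 = K\<^sup>2 + s"
  define C1 where "C1 = K2\<^sup>2 * second_moment_const"
  define C2 where "C2 = K\<^sup>2 * second_moment_const"
  have q0: "(\<Sum>x\<in>UNIV. (w x)\<^sup>2 - s) = 0"
    using card_ge_1 by (simp add: sum_subtractf s_eq)
  have qK: "\<bar>(w x)\<^sup>2 - s\<bar> \<le> K2" for x
  proof -
    have "(w x)\<^sup>2 \<le> K\<^sup>2" using w_bound[of x] K_ge_0 by (simp add: abs_le_square_iff[symmetric])
    then show ?thesis using s_ge_0 zero_le_power2[of "w x"] unfolding K2_def by linarith
  qed
  have bound: "variance_defect m \<le> (1 + C1) / sqrt (real m) + C2 / real m" if m: "m \<ge> 1" for m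
  proof -
    have r: "real m > 0" "sqrt (real m) > 0" using m by auto
    have "variance_defect m \<le> measure_pmf.expectation (erw_steps p m)
      (\<lambda>xs. 1 / sqrt (real m) + (\<Sum>j<m. (w (xs ! j))\<^sup>2 - s)\<^sup>2 / (real m * sqrt (real m)) + (proj_pos xs m)\<^sup>2 / (real m)\<^sup>2)"
      unfolding variance_defect_def
    proof (intro expectation_erw_steps_mono)
      fix xs :: "('d \<times> bool) list" assume len: "length xs = m"
      define Q where "Q = (\<Sum>j<m. (w (xs ! j))\<^sup>2 - s)"
      define R where "R = sqrt (real m)"
      have R: "R > 0" "real m = R * R" using r by (auto simp: R_def)
      have "\<bar>a * Q / real m\<bar> \<le> \<bar>Q\<bar> / real m"
        using abs_a_le r by (auto simp: abs_mult divide_right_mono mult_left_le_one_le)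
      \<comment> \<open>The inequality of arithmetic and geometric means, balanced at
        \<open>R = sqrt m\<close>, trades the first absolute moment of \<open>Q\<close> for its
        second moment.\<close>
      also have "\<bar>Q\<bar> / real m \<le> 1 / R + Q\<^sup>2 / (real m * R)"
      proof -
        have "0 \<le> (\<bar>Q\<bar> - R)\<^sup>2" by simp
        also have "\<dots> = Q\<^sup>2 - 2 * (\<bar>Q\<bar> * R) + R * R" by (simp add: power2_diff) (simp add: power2_eq_square)
        finally have "2 * (\<bar>Q\<bar> * R) \<le> R * R + Q\<^sup>2" by simp
        then have "\<bar>Q\<bar> * R \<le> R * R + Q\<^sup>2" using R by (smt (verit) mult_nonneg_nonneg abs_ge_zero)
        then show ?thesis using R by (simp add: field_simps)
      qed
      finally have 1: "\<bar>a * Q / real m\<bar> \<le> 1 / R + Q\<^sup>2 / (real m * R)" .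
      have "a\<^sup>2 \<le> 1" using abs_a_le by (simp add: abs_square_le_1)
      then have 2: "(a * proj_pos xs m / real m)\<^sup>2 \<le> (proj_pos xs m)\<^sup>2 / (real m)\<^sup>2"
        using r by (simp add: power_divide power_mult_distrib divide_right_mono mult_left_le_one_le)
      show "\<bar>measure_pmf.expectation (erw_next p xs) (\<lambda>x. (innovation xs x)\<^sup>2) - s\<bar>
        \<le> 1 / sqrt (real m) + (\<Sum>j<m. (w (xs ! j))\<^sup>2 - s)\<^sup>2 / (real m * sqrt (real m)) + (proj_pos xs m)\<^sup>2 / (real m)\<^sup>2"
        using 1 2 zero_le_power2[of "a * proj_pos xs m / real m"]
        unfolding innovation_variance len Q_def[symmetric] R_def[symmetric] by linarith
    qed
    also have "\<dots> = 1 / sqrt (real m)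
      + measure_pmf.expectation (erw_steps p m) (\<lambda>xs. (\<Sum>j<m. (w (xs ! j))\<^sup>2 - s)\<^sup>2) / (real m * sqrt (real m))
      + measure_pmf.expectation (erw_steps p m) (\<lambda>xs. (proj_pos xs m)\<^sup>2) / (real m)\<^sup>2"
      by simp
    also have "\<dots> \<le> 1 / sqrt (real m) + C1 * real m / (real m * sqrt (real m)) + C2 * real m / (real m)\<^sup>2"
      unfolding C1_def C2_def proj_pos_def
      by (intro add_mono divide_right_mono second_moment_bound q0 qK w_mean w_bound) auto
    also have "\<dots> = (1 + C1) / sqrt (real m) + C2 / real m"
      using r by (simp add: add_divide_distrib power2_eq_square)
    finally show ?thesis .
  qed
  have "(\<lambda>m. (1 + C1) * (1 / sqrt (real m)) + C2 * (1 / real m)) \<longlonglongrightarrow> (1 + C1) * 0 + C2 * 0"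
  proof (intro tendsto_intros lim_1_over_n)
    show "(\<lambda>m. 1 / sqrt (real m)) \<longlonglongrightarrow> 0"
      using tendsto_real_sqrt[OF lim_1_over_n] by (simp add: real_sqrt_divide)
  qed
  then have lim: "(\<lambda>m. (1 + C1) / sqrt (real m) + C2 / real m) \<longlonglongrightarrow> 0" by simp
  show ?thesis
  proof (rule tendsto_sandwich[OF _ _ tendsto_const lim])
    show "\<forall>\<^sub>F n in sequentially. 0 \<le> variance_defect n"
      by (simp add: variance_defect_def)
    show "\<forall>\<^sub>F n in sequentially. variance_defect n \<le> (1 + C1) / sqrt (real n) + C2 / real n"
      using bound by (auto simp: eventually_sequentially intro!: exI[of _ 1])
  qed
qed

text \<open>Conditioning on the first \<open>m\<close> steps pulls out the factor
  \<open>H xs\<close> of modulus 1; the remaining conditional characteristic function of the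
  innovation is close to a Gaussian one.\<close>

lemma center_char_step:
  fixes r :: real
  assumes "m < n"
  defines "\<theta> \<equiv> r * mem_weight a (Suc m) n"
  shows "norm (measure_pmf.expectation (erw_steps p (Suc m)) (\<lambda>xs. iexp (r * center_mart n (Suc m) xs))
      - exp (- (\<theta>\<^sup>2 * s / 2)) * measure_pmf.expectation (erw_steps p m) (\<lambda>xs. iexp (r * center_mart n m xs)))
    \<le> \<theta>\<^sup>2 / 2 * variance_defect m + (2 * K) ^ 3 / 6 * \<bar>\<theta>\<bar> ^ 3 + s\<^sup>2 / 8 * \<theta> ^ 4"
proof -
  define F where "F xs = measure_pmf.expectation (erw_next p xs) (\<lambda>x. iexp (\<theta> * innovation xs x))" for xs
  define c where "c = complex_of_real (exp (- (\<theta>\<^sup>2 * s / 2)))"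
  define H where "H xs = iexp (r * center_mart n m xs)" for xs
  have "measure_pmf.expectation (erw_steps p (Suc m)) (\<lambda>xs. iexp (r * center_mart n (Suc m) xs))
     = measure_pmf.expectation (erw_steps p m) (\<lambda>xs. H xs * F xs)"
    unfolding expectation_erw_steps_Suc
  proof (rule expectation_erw_steps_cong)
    fix xs :: "('d \<times> bool) list" assume len: "length xs = m"
    have "iexp (r * center_mart n (Suc m) (xs @ [x])) = H xs * iexp (\<theta> * innovation xs x)" for x
      by (simp add: center_mart_step[OF len assms(1)] H_def \<theta>_def algebra_simps flip: exp_add)
    then show "measure_pmf.expectation (erw_next p xs) (\<lambda>x. iexp (r * center_mart n (Suc m) (xs @ [x]))) = H xs * F xs"
      by (simp add: F_def)
  qed
  then have "norm (measure_pmf.expectation (erw_steps p (Suc m)) (\<lambda>xs. iexp (r * center_mart n (Suc m) xs))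
      - c * measure_pmf.expectation (erw_steps p m) H)
    = norm (measure_pmf.expectation (erw_steps p m) (\<lambda>xs. H xs * F xs - c * H xs))"
    by simp
  also have "\<dots> \<le> measure_pmf.expectation (erw_steps p m) (\<lambda>xs. norm (H xs * F xs - c * H xs))"
    by (rule integral_norm_bound)
  also have "\<dots> \<le> measure_pmf.expectation (erw_steps p m) (\<lambda>xs.
     \<theta>\<^sup>2 / 2 * \<bar>measure_pmf.expectation (erw_next p xs) (\<lambda>x. (innovation xs x)\<^sup>2) - s\<bar>
       + (2 * K) ^ 3 / 6 * \<bar>\<theta>\<bar> ^ 3 + s\<^sup>2 / 8 * \<theta> ^ 4)"
  proof (rule expectation_erw_steps_mono)
    fix xs :: "('d \<times> bool) list"
    have "norm (H xs * F xs - c * H xs) = norm (H xs * (F xs - c))" by (simp add: algebra_simps)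
    also have "\<dots> = norm (F xs - c)" by (simp add: norm_mult H_def)
    also have "\<dots> \<le> \<theta>\<^sup>2 / 2 * \<bar>measure_pmf.expectation (erw_next p xs) (\<lambda>x. (innovation xs x)\<^sup>2) - s\<bar>
       + (2 * K) ^ 3 / 6 * \<bar>\<theta>\<bar> ^ 3 + s\<^sup>2 / 8 * \<theta> ^ 4"
      unfolding F_def c_def
      by (intro char_centered_quadratic_bound abs_innovation_le innovation_mean s_ge_0) simp
    finally show "norm (H xs * F xs - c * H xs) \<le> \<dots>" .
  qed
  also have "\<dots> = \<theta>\<^sup>2 / 2 * variance_defect m + (2 * K) ^ 3 / 6 * \<bar>\<theta>\<bar> ^ 3 + s\<^sup>2 / 8 * \<theta> ^ 4"
    by (simp add: variance_defect_def)
  finally show ?thesis unfolding c_def H_def .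
qed

text \<open>The Gaussian factors are at most 1, so the one-step errors merely add up. The index
  \<open>j - 1\<close> appears because the \<open>j\<close>-th increment is conditioned on the first
  \<open>j - 1\<close> steps.\<close>

lemma center_char_bound:
  fixes r :: real
  assumes "m \<le> n"
  defines "\<theta> \<equiv> \<lambda>j. r * mem_weight a j n"
  shows "norm (measure_pmf.expectation (erw_steps p m) (\<lambda>xs. iexp (r * center_mart n m xs))
      - exp (- (s / 2 * (\<Sum>j=1..m. (\<theta> j)\<^sup>2))))
    \<le> (\<Sum>j=1..m. (\<theta> j)\<^sup>2 / 2 * variance_defect (j - 1) + (2 * K) ^ 3 / 6 * \<bar>\<theta> j\<bar> ^ 3 + s\<^sup>2 / 8 * \<theta> j ^ 4)"
  using assms(1)
proof (induction m)
  case 0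
  show ?case by (simp add: center_mart_def proj_pos_def)
next
  case (Suc m)
  let ?\<Psi> = "\<lambda>m. measure_pmf.expectation (erw_steps p m) (\<lambda>xs. iexp (r * center_mart n m xs))"
  define c where "c = exp (- ((\<theta> (Suc m))\<^sup>2 * s / 2))"
  define E where "E = exp (- (s / 2 * (\<Sum>j=1..m. (\<theta> j)\<^sup>2)))"
  have cE: "complex_of_real (exp (- (s / 2 * (\<Sum>j=1..Suc m. (\<theta> j)\<^sup>2)))) = of_real c * of_real E"
    unfolding of_real_mult[symmetric] of_real_eq_iff by (simp add: c_def E_def algebra_simps flip: exp_add)
  have 1: "norm (?\<Psi> (Suc m) - of_real c * ?\<Psi> m) \<le> (\<theta> (Suc m))\<^sup>2 / 2 * variance_defect m
      + (2 * K) ^ 3 / 6 * \<bar>\<theta> (Suc m)\<bar> ^ 3 + s\<^sup>2 / 8 * \<theta> (Suc m) ^ 4"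
    using center_char_step[of m n r] Suc.prems by (simp add: \<theta>_def c_def)
  have "norm (of_real c * ?\<Psi> m - of_real c * of_real E) = c * norm (?\<Psi> m - of_real E)"
    by (simp add: c_def norm_mult flip: right_diff_distrib)
  also have "\<dots> \<le> 1 * norm (?\<Psi> m - of_real E)"
    using s_ge_0 by (intro mult_right_mono) (auto simp: c_def)
  also have "\<dots> \<le> (\<Sum>j=1..m. (\<theta> j)\<^sup>2 / 2 * variance_defect (j - 1) + (2 * K) ^ 3 / 6 * \<bar>\<theta> j\<bar> ^ 3 + s\<^sup>2 / 8 * \<theta> j ^ 4)"
    using Suc unfolding E_def by simp
  finally have 2: "norm (of_real c * ?\<Psi> m - of_real c * of_real E) \<le> \<dots>" .
  have "norm (?\<Psi> (Suc m) - of_real c * of_real E) \<le> ((\<theta> (Suc m))\<^sup>2 / 2 * variance_defect m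
      + (2 * K) ^ 3 / 6 * \<bar>\<theta> (Suc m)\<bar> ^ 3 + s\<^sup>2 / 8 * \<theta> (Suc m) ^ 4)
      + (\<Sum>j=1..m. (\<theta> j)\<^sup>2 / 2 * variance_defect (j - 1) + (2 * K) ^ 3 / 6 * \<bar>\<theta> j\<bar> ^ 3 + s\<^sup>2 / 8 * \<theta> j ^ 4)"
    using norm_triangle_mono[OF 1 2] by (simp only: add_diff_eq diff_add_cancel)
  then show ?case unfolding cE by (simp add: add_ac del: erw_steps.simps)
qed

text \<open>The sum of squared normalized weights \<open>V n\<close> converges and their maximum is
  at most \<open>\<rho> n\<close>, which vanishes. Hence the cubic and quartic errors are bounded by
  \<open>V n\<close> times a null sequence.\<close>

theorem center_char_tendsto:
  "(\<lambda>n. measure_pmf.expectation (erw_steps p n)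
      (\<lambda>xs. iexp (1 / (real n * sqrt (real n)) * (\<Sum>k=1..n. \<Sum>j<k. w (xs ! j)))))
    \<longlonglongrightarrow> exp (- (s / 2 * (2 / (3 * (1 - 2 * a) * (2 - a)))))"
proof -
  define r where "r n = 1 / (real n * sqrt (real n))" for n
  define \<theta> where "\<theta> n j = r n * mem_weight a j n" for n j
  define V where "V n = (\<Sum>j=1..n. (\<theta> n j)\<^sup>2)" for n
  define \<rho> where "\<rho> n = mem_prod (max a 0) 1 n / sqrt (real n)" for n
  define \<Psi> where "\<Psi> n = measure_pmf.expectation (erw_steps p n) (\<lambda>xs. iexp (r n * (\<Sum>k=1..n. \<Sum>j<k. w (xs ! j))))" for n
  have r2: "(r n)\<^sup>2 = 1 / real n ^ 3" for n
    by (simp add: r_def power_divide power_mult_distrib power2_eq_square power3_eq_cube)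
  have th2: "(\<Sum>j=1..n. v j * (\<theta> n j)\<^sup>2) = (\<Sum>j=1..n. v j * mem_weight a j n ^ 2) / real n ^ 3" for v n
    by (simp add: \<theta>_def power_mult_distrib r2 sum_divide_distrib)
  have V: "V \<longlonglongrightarrow> 2 / (3 * (1 - 2 * a) * (2 - a))"
    using weighted_square_sum_asymptotics(1)[OF tendsto_const[of 1] a_less] th2[of "\<lambda>_. 1"]
    by (simp add: V_def[abs_def])
  \<comment> \<open>The shifted defects are inserted as the variances \<open>v\<close> in the
    weighted sum; their limit 0 makes the total variance error vanish.\<close>
  have "(\<lambda>n. variance_defect (n - 1)) \<longlonglongrightarrow> 0"
    using variance_defect_tendsto_0 LIMSEQ_offset[of "\<lambda>n. variance_defect (n - 1)" 1] by simp
  from weighted_square_sum_asymptotics(1)[OF this a_less]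
  have W: "(\<lambda>n. \<Sum>j=1..n. variance_defect (j - 1) * (\<theta> n j)\<^sup>2) \<longlonglongrightarrow> 0"
    unfolding th2 by simp
  have \<rho>: "\<rho> \<longlonglongrightarrow> 0"
    unfolding \<rho>_def using a_less by (intro mem_prod_over_sqrt_tendsto_0) auto
  have th_le: "\<bar>\<theta> n j\<bar> \<le> \<rho> n" if "j \<in> {1..n}" for n j
  proof -
    have n: "real n > 0" using that by auto
    have "\<bar>\<theta> n j\<bar> = r n * \<bar>mem_weight a j n\<bar>" by (simp add: \<theta>_def abs_mult r_def)
    also have "\<dots> \<le> r n * (real n * mem_prod (max a 0) 1 n)"
      using that a_ge by (intro mult_left_mono abs_mem_weight_le) (auto simp: r_def)
    also have "\<dots> = \<rho> n" using n by (simp add: r_def \<rho>_def)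
    finally show ?thesis .
  qed
  have bound: "norm (\<Psi> n - exp (- (s / 2 * V n)))
     \<le> 1 / 2 * (\<Sum>j=1..n. variance_defect (j - 1) * (\<theta> n j)\<^sup>2) + ((2 * K) ^ 3 / 6 * \<rho> n + s\<^sup>2 / 8 * (\<rho> n)\<^sup>2) * V n" for n
  proof -
    have "norm (\<Psi> n - exp (- (s / 2 * V n)))
      \<le> (\<Sum>j=1..n. (\<theta> n j)\<^sup>2 / 2 * variance_defect (j - 1) + (2 * K) ^ 3 / 6 * \<bar>\<theta> n j\<bar> ^ 3 + s\<^sup>2 / 8 * \<theta> n j ^ 4)"
      using center_char_bound[of n n "r n"] by (simp add: \<Psi>_def V_def \<theta>_def center_mart_def proj_pos_def)
    also have "\<dots> \<le> (\<Sum>j=1..n. 1 / 2 * (variance_defect (j - 1) * (\<theta> n j)\<^sup>2)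
        + ((2 * K) ^ 3 / 6 * \<rho> n + s\<^sup>2 / 8 * (\<rho> n)\<^sup>2) * (\<theta> n j)\<^sup>2)"
    proof (rule sum_mono)
      fix j assume j: "j \<in> {1..n}"
      note t = th_le[OF j]
      have "\<bar>\<theta> n j\<bar> ^ 3 = \<bar>\<theta> n j\<bar> * (\<theta> n j)\<^sup>2" by (simp add: power3_eq_cube power2_eq_square)
      also have "\<dots> \<le> \<rho> n * (\<theta> n j)\<^sup>2" using t by (intro mult_right_mono) auto
      finally have 3: "(2 * K) ^ 3 / 6 * \<bar>\<theta> n j\<bar> ^ 3 \<le> (2 * K) ^ 3 / 6 * (\<rho> n * (\<theta> n j)\<^sup>2)"
        using K_ge_0 by (intro mult_left_mono) auto
      have "\<theta> n j ^ 4 = \<bar>\<theta> n j\<bar>\<^sup>2 * (\<theta> n j)\<^sup>2" by (simp flip: power_add)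
      also have "\<dots> \<le> (\<rho> n)\<^sup>2 * (\<theta> n j)\<^sup>2" using t by (intro mult_right_mono power_mono) auto
      finally have 4: "s\<^sup>2 / 8 * \<theta> n j ^ 4 \<le> s\<^sup>2 / 8 * ((\<rho> n)\<^sup>2 * (\<theta> n j)\<^sup>2)"
        by (intro mult_left_mono) auto
      show "(\<theta> n j)\<^sup>2 / 2 * variance_defect (j - 1) + (2 * K) ^ 3 / 6 * \<bar>\<theta> n j\<bar> ^ 3 + s\<^sup>2 / 8 * \<theta> n j ^ 4
        \<le> 1 / 2 * (variance_defect (j - 1) * (\<theta> n j)\<^sup>2)
        + ((2 * K) ^ 3 / 6 * \<rho> n + s\<^sup>2 / 8 * (\<rho> n)\<^sup>2) * (\<theta> n j)\<^sup>2"
        using 3 4 by (simp add: distrib_right mult.assoc) (simp add: mult_ac)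
    qed
    also have "\<dots> = 1 / 2 * (\<Sum>j=1..n. variance_defect (j - 1) * (\<theta> n j)\<^sup>2)
        + ((2 * K) ^ 3 / 6 * \<rho> n + s\<^sup>2 / 8 * (\<rho> n)\<^sup>2) * V n"
      by (simp only: V_def sum.distrib sum_distrib_left)
    finally show ?thesis .
  qed
  have "(\<lambda>n. 1 / 2 * (\<Sum>j=1..n. variance_defect (j - 1) * (\<theta> n j)\<^sup>2) + ((2 * K) ^ 3 / 6 * \<rho> n + s\<^sup>2 / 8 * (\<rho> n)\<^sup>2) * V n)
    \<longlonglongrightarrow> 1 / 2 * 0 + ((2 * K) ^ 3 / 6 * 0 + s\<^sup>2 / 8 * 0\<^sup>2) * (2 / (3 * (1 - 2 * a) * (2 - a)))"
    by (intro tendsto_intros W \<rho> V)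
  then have "(\<lambda>n. 1 / 2 * (\<Sum>j=1..n. variance_defect (j - 1) * (\<theta> n j)\<^sup>2) + ((2 * K) ^ 3 / 6 * \<rho> n + s\<^sup>2 / 8 * (\<rho> n)\<^sup>2) * V n) \<longlonglongrightarrow> 0"
    by simp
  then have diff: "(\<lambda>n. \<Psi> n - complex_of_real (exp (- (s / 2 * V n)))) \<longlonglongrightarrow> 0"
    by (rule Lim_null_comparison[rotated]) (intro always_eventually allI bound)
  have "(\<lambda>n. complex_of_real (exp (- (s / 2 * V n)))) \<longlonglongrightarrow> complex_of_real (exp (- (s / 2 * (2 / (3 * (1 - 2 * a) * (2 - a))))))"
    by (intro tendsto_intros V)
  from tendsto_add[OF diff this] show ?thesis by (simp add: \<Psi>_def[abs_def] r_def)
qed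

end

end

section \<open>Weak convergence from characteristic functions\<close>

inductive trig_poly :: "('a::real_inner \<Rightarrow> complex) \<Rightarrow> bool" where
  monomial: "trig_poly (\<lambda>x. c * iexp (u \<bullet> x))"
| add: "trig_poly f \<Longrightarrow> trig_poly g \<Longrightarrow> trig_poly (\<lambda>x. f x + g x)"

lemma trig_poly_const: "trig_poly (\<lambda>x. c)"
  using trig_poly.monomial[of c 0] by simp

lemma trig_poly_mult:
  assumes "trig_poly f" "trig_poly g"
  shows "trig_poly (\<lambda>x. f x * g x)"
  using assms
proof (induction f rule: trig_poly.induct)
  case (monomial c u)
  then show ?case
  proof (induction g rule: trig_poly.induct)
    case (monomial c' u')
    have "(\<lambda>x. c * iexp (u \<bullet> x) * (c' * iexp (u' \<bullet> x))) = (\<lambda>x. (c * c') * iexp ((u + u') \<bullet> x))"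
      by (auto simp: inner_add_left distrib_left exp_add)
    then show ?case using trig_poly.monomial[of "c * c'" "u + u'"] by simp
  next
    case (add f g)
    then show ?case using trig_poly.add[OF add.IH] by (simp add: distrib_left)
  qed
next
  case (add f h)
  then show ?case using trig_poly.add[OF add.IH(1) add.IH(2)] by (simp add: distrib_right)
qed

lemma trig_poly_sum:
  "finite A \<Longrightarrow> (\<And>i. i \<in> A \<Longrightarrow> trig_poly (f i)) \<Longrightarrow> trig_poly (\<lambda>x. \<Sum>i\<in>A. f i x)"
  by (induction A rule: finite_induct) (auto intro: trig_poly_const trig_poly.add)

lemma trig_poly_sin: "trig_poly (\<lambda>x::real^'d. complex_of_real (sin (x $ i / L)))"
proof -
  have "complex_of_real (sin (x $ i / L)) = - \<i> / 2 * iexp (axis i (1 / L) \<bullet> x) + \<i> / 2 * iexp (axis i (- 1 / L) \<bullet> x)"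
    for x :: "real^'d"
  proof -
    have 1: "axis i (1 / L) \<bullet> x = x $ i / L" "axis i (- 1 / L) \<bullet> x = - (x $ i / L)"
      by (simp_all add: inner_axis')
    show ?thesis
      unfolding 1 by (simp add: complex_eq_iff Re_exp Im_exp)
  qed
  then show ?thesis by (simp only:) (intro trig_poly.intros)
qed

text \<open>Trigonometric polynomials form an algebra containing the coordinate sines. This links
  polynomial approximation on a cube to characteristic functions.\<close>

lemma trig_poly_polynomial_sin:
  fixes q :: "real ^ 'd \<Rightarrow> real"
  assumes "real_polynomial_function q"
  shows "trig_poly (\<lambda>x. complex_of_real (q (\<chi> i. sin (x $ i / L))))"
  using assms
proof induction
  case (linear f)
  interpret bounded_linear f by fact
  have lin: "f y = (\<Sum>i\<in>UNIV. f (axis i 1) * y $ i)" for y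
  proof -
    have "f y = f (\<Sum>i\<in>UNIV. y $ i *\<^sub>R axis i 1)"
      using basis_expansion[of y] by (simp add: scalar_mult_eq_scaleR)
    then show ?thesis by (simp add: sum scaleR mult.commute)
  qed
  have "(\<lambda>x. complex_of_real (f (\<chi> i. sin (x $ i / L))))
     = (\<lambda>x. \<Sum>i\<in>UNIV. complex_of_real (f (axis i 1)) * complex_of_real (sin (x $ i / L)))"
    by (intro ext, subst lin) simp
  then show ?case
    by (simp only:) (intro trig_poly_sum trig_poly_mult trig_poly_const trig_poly_sin finite)
next
  case (const c)
  show ?case by (rule trig_poly_const)
next
  case (add f g)
  then show ?case using trig_poly.add[OF add.IH] by simp
next
  case (mult f g)
  then show ?case using trig_poly_mult[OF mult.IH] by simp
qed

lemma integrable_pmf_bounded: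
  fixes f :: "'a \<Rightarrow> 'c::{banach, second_countable_topology}"
  assumes "\<And>x. norm (f x) \<le> B"
  shows "integrable (measure_pmf M) f"
  using assms by (intro measure_pmf.integrable_const_bound[where B = B]) auto

text \<open>Integrability is carried through the induction because additivity of the integral relies
  on it.\<close>

lemma trig_poly_expectation_tendsto:
  fixes M :: "nat \<Rightarrow> ('a::euclidean_space) pmf" and N :: "'a measure"
  assumes "prob_space N" and N: "sets N = sets borel"
    and char: "\<And>u. (\<lambda>n. measure_pmf.expectation (M n) (\<lambda>x. iexp (u \<bullet> x))) \<longlonglongrightarrow> (\<integral>x. iexp (u \<bullet> x) \<partial>N)"
    and "trig_poly f"
  shows "(\<forall>n. integrable (measure_pmf (M n)) f) \<and> integrable N f \<and>
    (\<lambda>n. measure_pmf.expectation (M n) f) \<longlonglongrightarrow> (\<integral>x. f x \<partial>N)"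
  using \<open>trig_poly f\<close>
proof induction
  case (monomial c u)
  interpret prob_space N by fact
  have "(\<lambda>x. iexp (u \<bullet> x)) \<in> borel_measurable N"
    unfolding measurable_cong_sets[OF N refl] by measurable
  then have "integrable N (\<lambda>x. iexp (u \<bullet> x))"
    by (intro integrable_const_bound[where B = 1]) auto
  moreover have "integrable (measure_pmf (M n)) (\<lambda>x. iexp (u \<bullet> x))" for n
    by (intro integrable_pmf_bounded[where B = 1]) auto
  ultimately show ?case using tendsto_mult_left[OF char] by simp
next
  case (add f g)
  then show ?case by (auto intro: tendsto_add)
qed

text \<open>Trigonometric polynomials are periodic, so they see \<open>f\<close> only through its folded version
  \<open>f (\<chi> i. L * arcsin (sin (x $ i / L)))\<close>, which agrees with \<open>f\<close> on the ball of radius \<open>L\<close>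
  and is a continuous function of the bounded quantities \<open>sin (x $ i / L)\<close>.\<close>

theorem conv_in_distr_if_char_tendsto:
  fixes M :: "nat \<Rightarrow> (real ^ 'd) pmf" and N :: "(real ^ 'd) measure"
  assumes prob: "prob_space N" and N: "sets N = sets borel"
    and char: "\<And>u. (\<lambda>n. measure_pmf.expectation (M n) (\<lambda>x. iexp (u \<bullet> x))) \<longlonglongrightarrow> (\<integral>x. iexp (u \<bullet> x) \<partial>N)"
    and int2: "\<And>n. integrable (measure_pmf (M n)) (\<lambda>x. (norm x)\<^sup>2)"
    and mom2: "\<And>n. measure_pmf.expectation (M n) (\<lambda>x. (norm x)\<^sup>2) \<le> C"
  shows "conv_in_distr (\<lambda>n. measure_pmf (M n)) N"
  unfolding conv_in_distr_def
proof (intro allI impI, elim conjE)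
  fix f :: "real ^ 'd \<Rightarrow> real"
  assume cont: "continuous_on UNIV f" and bdd: "bounded (range f)"
  interpret prob_space N by (rule prob)
  obtain B where B: "\<And>x. \<bar>f x\<bar> \<le> B"
    using bdd by (auto simp: bounded_iff)
  have B0: "B \<ge> 0" using B[of 0] by linarith
  define fL where "fL L x = f (\<chi> i. L * arcsin (sin (x $ i / L)))" for L :: real and x
  have meas: "g \<in> borel_measurable N" if "continuous_on UNIV g" for g :: "real ^ 'd \<Rightarrow> real"
    unfolding measurable_cong_sets[OF N refl] using that by (rule borel_measurable_continuous_onI)
  have contL: "continuous_on UNIV (fL L)" for L
    unfolding fL_def divide_inverse
    by (intro continuous_on_compose2[OF cont] continuous_intros) auto
  have boundL: "\<bar>fL L x\<bar> \<le> B" for L x by (simp add: fL_def B)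
  have eqL: "fL L x = f x" if "norm x \<le> L" "L > 0" for L x
  proof -
    have "L * arcsin (sin (x $ i / L)) = x $ i" for i
    proof -
      have "\<bar>x $ i\<bar> \<le> L" using component_le_norm_cart[of x i] that by linarith
      then have "\<bar>x $ i / L\<bar> \<le> 1" using that by (simp add: divide_le_eq)
      moreover have "1 \<le> pi / 2" using pi_ge_two by simp
      ultimately have "arcsin (sin (x $ i / L)) = x $ i / L"
        by (intro arcsin_sin) linarith+
      then show ?thesis using that by simp
    qed
    then show ?thesis by (simp add: fL_def)
  qed
  show "(\<lambda>n. measure_pmf.expectation (M n) f) \<longlonglongrightarrow> (\<integral>x. f x \<partial>N)"
  proof (rule LIMSEQ_I)
    fix e0 :: real assume e0: "e0 > 0"
    \<comment> \<open>Five errors are combined: folding under \<open>M n\<close> and under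
      \<open>N\<close>, polynomial approximation under each of them, and the convergence of the
      expectations of \<open>g\<close>.\<close>
    define e where "e = e0 / 5"
    have e: "e > 0" using e0 by (simp add: e_def)
    \<comment> \<open>Under \<open>N\<close> the folding error vanishes by dominated convergence, as
      every fixed point eventually lies in the ball. Under \<open>M n\<close> it is controlled
      uniformly in \<open>n\<close> by the second moments.\<close>
    have "(\<lambda>k. \<integral>x. fL (real k) x \<partial>N) \<longlonglongrightarrow> (\<integral>x. f x \<partial>N)"
    proof (rule integral_dominated_convergence[where w = "\<lambda>_. B"])
      show "AE x in N. (\<lambda>k. fL (real k) x) \<longlonglongrightarrow> f x"
      proof (rule AE_I2)
        fix x :: "real ^ 'd"
        have "\<forall>\<^sub>F k in sequentially. real k \<ge> max 1 (norm x)"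
          using filterlim_real_sequentially by (simp only: filterlim_at_top)
        then have "\<forall>\<^sub>F k in sequentially. fL (real k) x = f x"
          by eventually_elim (auto intro: eqL)
        then show "(\<lambda>k. fL (real k) x) \<longlonglongrightarrow> f x" by (rule tendsto_eventually)
      qed
    qed (auto intro: meas contL cont boundL)
    then have "\<forall>\<^sub>F k in sequentially. dist (\<integral>x. fL (real k) x \<partial>N) (\<integral>x. f x \<partial>N) < e"
      using e by (rule tendstoD)
    moreover have "\<forall>\<^sub>F k in sequentially. real k \<ge> max 1 (2 * B * C / e)"
      using filterlim_real_sequentially by (simp only: filterlim_at_top)
    ultimately have "\<forall>\<^sub>F k in sequentially. dist (\<integral>x. fL (real k) x \<partial>N) (\<integral>x. f x \<partial>N) < e \<and> real k \<ge> max 1 (2 * B * C / e)"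
      by eventually_elim simp
    then obtain k where k: "\<bar>(\<integral>x. fL (real k) x \<partial>N) - (\<integral>x. f x \<partial>N)\<bar> < e" "real k \<ge> 1" "real k \<ge> 2 * B * C / e"
      using eventually_happens'[OF sequentially_bot] by (auto simp: dist_real_def)
    define L where "L = real k"
    have L: "L \<ge> 1" "2 * B / L\<^sup>2 * C \<le> e"
    proof -
      show L1: "L \<ge> 1" using k by (simp add: L_def)
      have "2 * B * C \<le> e * L" using k e by (simp add: L_def divide_le_eq mult.commute)
      also have "\<dots> \<le> e * L\<^sup>2" using e L1 by (intro mult_left_mono) (auto simp: power2_eq_square)
      finally show "2 * B / L\<^sup>2 * C \<le> e" using L1 by (simp add: divide_le_eq)
    qed
    have tail: "\<bar>measure_pmf.expectation (M n) f - measure_pmf.expectation (M n) (fL L)\<bar> \<le> e" for n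
    proof -
      have i1: "integrable (measure_pmf (M n)) f" "integrable (measure_pmf (M n)) (fL L)"
        using B boundL by (auto intro!: integrable_pmf_bounded[where B = B])
      have "\<bar>measure_pmf.expectation (M n) f - measure_pmf.expectation (M n) (fL L)\<bar>
        = norm (measure_pmf.expectation (M n) (\<lambda>x. f x - fL L x))" using i1 by simp
      also have "\<dots> \<le> measure_pmf.expectation (M n) (\<lambda>x. norm (f x - fL L x))"
        by (rule integral_norm_bound)
      \<comment> \<open>A Chebyshev estimate: the integrand is 0 on the ball of radius
        \<open>L\<close>, and outside it the bound \<open>2 * B\<close> may be multiplied by
        \<open>(norm x / L)^2\<close>.\<close>
      also have "\<dots> \<le> measure_pmf.expectation (M n) (\<lambda>x. 2 * B / L\<^sup>2 * (norm x)\<^sup>2)"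
      proof (intro integral_mono)
        show "norm (f x - fL L x) \<le> 2 * B / L\<^sup>2 * (norm x)\<^sup>2" for x
        proof (cases "norm x \<le> L")
          case True
          then show ?thesis using eqL[of x L] L B0 by simp
        next
          case False
          have "norm (f x - fL L x) \<le> 2 * B" using B[of x] boundL[of L x] by simp
          also have "\<dots> \<le> 2 * B * ((norm x)\<^sup>2 / L\<^sup>2)"
          proof -
            have "1 \<le> (norm x)\<^sup>2 / L\<^sup>2" using False L by (simp add: le_divide_eq power_mono)
            from mult_left_mono[OF this, of "2 * B"] show ?thesis using B0 by simp
          qed
          finally show ?thesis by simp
        qed
      qed (use i1 int2 in auto)
      also have "\<dots> = 2 * B / L\<^sup>2 * measure_pmf.expectation (M n) (\<lambda>x. (norm x)\<^sup>2)"
        by simp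
      also have "\<dots> \<le> 2 * B / L\<^sup>2 * C" using B0 by (intro mult_left_mono mom2) auto
      also have "\<dots> \<le> e" by (rule L)
      finally show ?thesis .
    qed
    \<comment> \<open>A cube containing all vectors of sines, on which the folded function is
      continuous in those sines.\<close>
    define S :: "(real ^ 'd) set" where "S = cbox (\<chi> i. -1) (\<chi> i. 1)"
    have S: "y \<in> S \<longleftrightarrow> (\<forall>i. -1 \<le> y $ i \<and> y $ i \<le> 1)" for y by (simp add: S_def mem_box_cart)
    have "continuous_on S (\<lambda>y. f (\<chi> i. L * arcsin (y $ i)))"
      by (intro continuous_on_compose2[OF cont] continuous_intros) (auto simp: S)
    moreover have "compact S" unfolding S_def by (rule compact_cbox)
    ultimately obtain q where q: "real_polynomial_function q"
      and qe: "\<And>y. y \<in> S \<Longrightarrow> \<bar>f (\<chi> i. L * arcsin (y $ i)) - q y\<bar> < e"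
      using Stone_Weierstrass_real_polynomial_function[of S _ e] e by blast
    define g where "g x = q (\<chi> i. sin (x $ i / L))" for x
    have ge: "\<bar>fL L x - g x\<bar> \<le> e" for x
      using qe[of "\<chi> i. sin (x $ i / L)"] by (auto simp: S g_def fL_def)
    have "trig_poly (\<lambda>x. complex_of_real (g x))"
      unfolding g_def by (rule trig_poly_polynomial_sin[OF q])
    from trig_poly_expectation_tendsto[OF prob N char this]
    have gi: "\<And>n. integrable (measure_pmf (M n)) g" "integrable N g"
      and gl: "(\<lambda>n. measure_pmf.expectation (M n) g) \<longlonglongrightarrow> (\<integral>x. g x \<partial>N)"
      by (simp_all add: tendsto_of_real_iff complex_of_real_integrable_eq)
    have close: "\<bar>(\<integral>x. fL L x \<partial>P) - (\<integral>x. g x \<partial>P)\<bar> \<le> e"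
      if "prob_space P" "integrable P g" "integrable P (fL L)" for P
    proof -
      interpret P: prob_space P by fact
      have "\<bar>(\<integral>x. fL L x \<partial>P) - (\<integral>x. g x \<partial>P)\<bar> = norm (\<integral>x. fL L x - g x \<partial>P)" using that by simp
      also have "\<dots> \<le> (\<integral>x. norm (fL L x - g x) \<partial>P)" by (rule integral_norm_bound)
      also have "\<dots> \<le> (\<integral>x. e \<partial>P)" using that ge by (intro integral_mono) auto
      finally show ?thesis by (simp add: P.prob_space)
    qed
    have c1: "\<bar>measure_pmf.expectation (M n) (fL L) - measure_pmf.expectation (M n) g\<bar> \<le> e" for n
      using boundL by (intro close measure_pmf.prob_space_axioms gi integrable_pmf_bounded[where B = B]) auto
    have c2: "\<bar>(\<integral>x. fL L x \<partial>N) - (\<integral>x. g x \<partial>N)\<bar> \<le> e"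
      using boundL meas[OF contL] by (intro close prob gi integrable_const_bound[where B = B]) auto
    from tendstoD[OF gl e] obtain n0 where
      n0: "\<And>n. n \<ge> n0 \<Longrightarrow> \<bar>measure_pmf.expectation (M n) g - (\<integral>x. g x \<partial>N)\<bar> < e"
      by (auto simp: eventually_sequentially dist_real_def)
    have "norm (measure_pmf.expectation (M n) f - (\<integral>x. f x \<partial>N)) < e0" if "n \<ge> n0" for n
      using n0[OF that] c1[of n] c2 tail[of n] k(1) unfolding L_def[symmetric] real_norm_def
      by (simp only: e_def)
    then show "\<exists>no. \<forall>n\<ge>no. norm (measure_pmf.expectation (M n) f - (\<integral>x. f x \<partial>N)) < e0" by blast
  qed
qed

section \<open>The isotropic normal distribution\<close>

lemma prod_Basis_vec:
  fixes F :: "real ^ 'd \<Rightarrow> 'b::comm_monoid_mult"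
  shows "(\<Prod>b\<in>Basis. F b) = (\<Prod>i\<in>UNIV. F (axis i 1))"
proof -
  have B: "(Basis :: (real ^ 'd) set) = range (\<lambda>i. axis i 1)" by (auto simp: Basis_vec_def)
  have I: "inj (\<lambda>i::'d. axis i (1::real))" by (auto simp: inj_on_def axis_eq_axis)
  show ?thesis unfolding B prod.reindex[OF I] by (simp add: o_def)
qed

lemma prob_space_normal_iso:
  assumes "s2 > 0"
  shows "prob_space (normal_iso s2 :: (real ^ 'd::finite) measure)"
proof
  define \<sigma> where "\<sigma> = sqrt s2"
  have \<sigma>: "\<sigma> > 0" using assms by (simp add: \<sigma>_def)
  have one: "(\<integral>\<^sup>+t. ennreal (normal_density 0 \<sigma> t) \<partial>lborel) = 1"
    using \<sigma> by (subst nn_integral_eq_integral) auto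
  have "emeasure (normal_iso s2 :: (real ^ 'd) measure) (space (normal_iso s2))
     = (\<integral>\<^sup>+x. ennreal (\<Prod>i\<in>UNIV. normal_density 0 \<sigma> (x $ i)) \<partial>(lborel :: (real ^ 'd) measure))"
    unfolding normal_iso_def \<sigma>_def by (subst emeasure_density) (auto simp: space_density)
  also have "\<dots> = (\<integral>\<^sup>+x. (\<Prod>b\<in>Basis. ennreal (normal_density 0 \<sigma> (x \<bullet> b))) \<partial>(lborel :: (real ^ 'd) measure))"
    by (simp add: prod_Basis_vec prod_ennreal inner_axis)
  also have "\<dots> = (\<Prod>b\<in>(Basis :: (real ^ 'd) set). (\<integral>\<^sup>+t. ennreal (normal_density 0 \<sigma> t) \<partial>lborel))"
    by (subst nn_integral_lborel_prod[where f = "\<lambda>_ t. ennreal (normal_density 0 \<sigma> t)"]) auto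
  also have "\<dots> = 1" by (simp add: one)
  finally show "emeasure (normal_iso s2 :: (real ^ 'd) measure) (space (normal_iso s2)) = 1" .
qed

text \<open>The substitution \<open>x = \<sigma> * y\<close> reduces this to the known
  characteristic function of the standard normal law.\<close>

lemma char_normal_density:
  fixes \<sigma> t :: real
  assumes \<sigma>: "\<sigma> > 0"
  shows "integrable lborel (\<lambda>x. normal_density 0 \<sigma> x *\<^sub>R iexp (t * x))" (is ?int)
    and "(\<integral>x. normal_density 0 \<sigma> x *\<^sub>R iexp (t * x) \<partial>lborel) = exp (- (\<sigma>\<^sup>2 * t\<^sup>2 / 2))" (is ?eq)
proof -
  show ?int
  proof (rule Bochner_Integration.integrable_bound)
    show "integrable lborel (normal_density 0 \<sigma>)" using \<sigma> by simp
  qed auto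
  have "(\<integral>x. normal_density 0 \<sigma> x *\<^sub>R iexp (t * x) \<partial>lborel)
    = \<bar>\<sigma>\<bar> *\<^sub>R (\<integral>x. normal_density 0 \<sigma> (0 + \<sigma> * x) *\<^sub>R iexp (t * (0 + \<sigma> * x)) \<partial>lborel)"
    using \<sigma> by (intro lborel_integral_real_affine) auto
  also have "\<dots> = (\<integral>x. std_normal_density x *\<^sub>R iexp ((t * \<sigma>) * x) \<partial>lborel)"
  proof -
    have "\<sigma> * normal_density 0 \<sigma> (\<sigma> * x) = std_normal_density x" for x
      using \<sigma> by (simp add: normal_density_def power_mult_distrib real_sqrt_mult)
    then show ?thesis using \<sigma> by (simp add: mult.assoc flip: integral_scaleR_right)
  qed
  also have "\<dots> = char std_normal_distribution (t * \<sigma>)"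
    unfolding char_def by (subst integral_density) auto
  also have "\<dots> = exp (- (\<sigma>\<^sup>2 * t\<^sup>2 / 2))"
    by (simp add: char_std_normal_distribution power_mult_distrib mult.commute)
  finally show ?eq .
qed

text \<open>Density and exponential both factor over the coordinates, so Fubini reduces the integral
  to one-dimensional Gaussian ones.\<close>

lemma char_normal_iso:
  fixes u :: "real ^ 'd::finite"
  assumes s2: "s2 > 0"
  shows "(\<integral>x. iexp (u \<bullet> x) \<partial>normal_iso s2) = exp (- (s2 * (norm u)\<^sup>2 / 2))"
proof -
  define \<sigma> where "\<sigma> = sqrt s2"
  have \<sigma>: "\<sigma> > 0" "\<sigma>\<^sup>2 = s2" using assms by (auto simp: \<sigma>_def)
  define h where "h b t = normal_density 0 \<sigma> t *\<^sub>R iexp ((u \<bullet> b) * t)" for b :: "real ^ 'd" and t :: real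
  interpret product_sigma_finite "\<lambda>_ :: real ^ 'd. lborel :: real measure" ..
  have [measurable]: "h b \<in> borel_measurable borel" for b unfolding h_def by measurable
  have "(\<integral>x. iexp (u \<bullet> x) \<partial>normal_iso s2)
    = (\<integral>x. (\<Prod>i\<in>UNIV. normal_density 0 \<sigma> (x $ i)) *\<^sub>R iexp (u \<bullet> x) \<partial>lborel)"
    unfolding normal_iso_def \<sigma>_def by (subst integral_density) (auto intro!: prod_nonneg)
  also have "\<dots> = (\<integral>x. (\<Prod>b\<in>Basis. h b (x \<bullet> b)) \<partial>lborel)"
  proof (rule Bochner_Integration.integral_cong[OF refl])
    fix x :: "real ^ 'd"
    have "iexp (u \<bullet> x) = (\<Prod>i\<in>UNIV. iexp (u $ i * x $ i))"
      by (simp add: inner_vec_def sum_distrib_left exp_sum)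
    then show "(\<Prod>i\<in>UNIV. normal_density 0 \<sigma> (x $ i)) *\<^sub>R iexp (u \<bullet> x) = (\<Prod>b\<in>Basis. h b (x \<bullet> b))"
      by (simp add: prod_Basis_vec h_def inner_axis scaleR_conv_of_real prod.distrib)
  qed
  also have "\<dots> = (\<integral>f. (\<Prod>b\<in>Basis. h b (f b)) \<partial>(\<Pi>\<^sub>M b\<in>Basis. lborel))"
    \<comment> \<open>Lebesgue measure on the vector space is the image of the product of
      one-dimensional ones over \<open>Basis\<close>.\<close>
    by (subst lborel_eq, subst integral_distr) (auto intro!: Bochner_Integration.integral_cong prod.cong)
  also have "\<dots> = (\<Prod>b\<in>Basis. \<integral>t. h b t \<partial>lborel)"
    unfolding h_def by (intro product_integral_prod char_normal_density(1)[OF \<sigma>(1)]) simp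
  also have "\<dots> = (\<Prod>i\<in>UNIV. complex_of_real (exp (- (s2 * (u $ i)\<^sup>2 / 2))))"
    unfolding prod_Basis_vec h_def char_normal_density(2)[OF \<sigma>(1)] by (simp add: \<sigma> inner_axis)
  also have "\<dots> = complex_of_real (exp (\<Sum>i\<in>UNIV. - (s2 * (u $ i)\<^sup>2 / 2)))"
    by (simp add: exp_sum)
  also have "(\<Sum>i\<in>UNIV. - (s2 * (u $ i)\<^sup>2 / 2)) = - (s2 * (norm u)\<^sup>2 / 2)"
    by (simp add: norm_vec_def L2_set_def sum_nonneg sum_negf sum_distrib_left sum_divide_distrib)
  finally show ?thesis .
qed

section \<open>The center of mass\<close>

lemma sum_UNIV_prod_bool:
  fixes f :: "'d::finite \<times> bool \<Rightarrow> real"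
  shows "(\<Sum>x\<in>UNIV. f x) = (\<Sum>i\<in>UNIV. f (i, True) + f (i, False))"
  by (simp add: UNIV_bool sum.cartesian_product' add.commute flip: UNIV_Times_UNIV)

lemma inner_dir_vec:
  "u \<bullet> dir_vec (i, b) = (if b then u $ i else - u $ i)"
  by (simp add: dir_vec_def inner_axis)

lemma sum_inner_dir_vec: "(\<Sum>x\<in>UNIV. u \<bullet> dir_vec x) = 0"
  by (simp add: sum_UNIV_prod_bool inner_dir_vec)

lemma sum_inner_dir_vec_squared: "(\<Sum>x\<in>UNIV. (u \<bullet> dir_vec x)\<^sup>2) = 2 * (norm u)\<^sup>2"
  by (simp add: sum_UNIV_prod_bool inner_dir_vec norm_vec_def L2_set_def sum_nonneg sum_distrib_left)

lemma abs_inner_dir_vec_le: "\<bar>u \<bullet> dir_vec x\<bar> \<le> norm u"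
  using component_le_norm_cart[of u "fst x"] by (cases x) (auto simp: inner_dir_vec)

lemma inner_scaled_center:
  "u \<bullet> ((1 / sqrt (real n)) *\<^sub>R erw_center xs n) =
     1 / (real n * sqrt (real n)) * (\<Sum>k=1..n. \<Sum>j<k. u \<bullet> dir_vec (xs ! j))"
  by (simp add: erw_center_def erw_pos_def inner_sum_right)

theorem theorem2p3:
  fixes p :: real and a :: real
  assumes "0 \<le> p" and "p \<le> 1"
    and "p < (2 * real CARD('d::finite) + 1) / (4 * real CARD('d))"
    and "a = (2 * real CARD('d) * p - 1) / (2 * real CARD('d) - 1)"
  shows "conv_in_distr
           (\<lambda>n. measure_pmf (map_pmf (\<lambda>xs. (1 / sqrt (real n)) *\<^sub>R erw_center xs n)
                                    (erw_steps p n :: ('d \<times> bool) list pmf)))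
           (normal_iso (2 / (3 * (1 - 2 * a) * (2 - a) * real CARD('d))) :: (real ^ 'd) measure)"
proof -
  define D where "D = real CARD('d)"
  have "CARD('d) \<ge> 1" by (simp add: Suc_leI)
  then have D: "D \<ge> 1" unfolding D_def by linarith
  have "2 * D * p - 1 < (2 * D - 1) / 2"
    using assms(3) D unfolding D_def[symmetric] by (simp add: field_simps)
  then have a: "a < 1 / 2"
    using D unfolding assms(4) D_def[symmetric] by (simp add: field_simps)
  interpret elephant p a "TYPE('d)"
    using assms a by unfold_locales auto
  define s2 where "s2 = 2 / (3 * (1 - 2 * a) * (2 - a) * D)"
  have s2: "s2 > 0" using a D by (auto simp: s2_def)
  define M where "M n = map_pmf (\<lambda>xs. (1 / sqrt (real n)) *\<^sub>R erw_center xs n)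
                                    (erw_steps p n :: ('d \<times> bool) list pmf)" for n
  have "conv_in_distr (\<lambda>n. measure_pmf (M n)) (normal_iso s2)"
  proof (rule conv_in_distr_if_char_tendsto)
    show "prob_space (normal_iso s2 :: (real ^ 'd) measure)" using s2 by (rule prob_space_normal_iso)
    show "sets (normal_iso s2 :: (real ^ 'd) measure) = sets borel" by (simp add: normal_iso_def)
    show "integrable (measure_pmf (M n)) (\<lambda>x. (norm x)\<^sup>2)" for n
      by (intro integrable_measure_pmf_finite) (simp add: M_def)
    show "(\<lambda>n. measure_pmf.expectation (M n) (\<lambda>x. iexp (u \<bullet> x))) \<longlonglongrightarrow> (\<integral>x. iexp (u \<bullet> x) \<partial>normal_iso s2)" for u
    proof -
      define s where "s = (\<Sum>x\<in>(UNIV :: ('d \<times> bool) set). (u \<bullet> dir_vec x)\<^sup>2) / (2 * real CARD('d))"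
      \<comment> \<open>Each coordinate of \<open>u\<close> occurs with both signs among the
        directions, so \<open>s\<close> is the squared norm of \<open>u\<close> divided by
        \<open>D\<close>.\<close>
      have s: "s / 2 * (2 / (3 * (1 - 2 * a) * (2 - a))) = s2 * (norm u)\<^sup>2 / 2"
        by (simp add: s_def s2_def sum_inner_dir_vec_squared D_def mult_ac)
      show ?thesis
        using center_char_tendsto[OF sum_inner_dir_vec abs_inner_dir_vec_le s_def]
        unfolding s char_normal_iso[OF s2] M_def integral_map_pmf inner_scaled_center .
    qed
    show "measure_pmf.expectation (M n) (\<lambda>x. (norm x)\<^sup>2) \<le> D * second_moment_const" for n
    proof -
      define c where "c = 1 / (real n * sqrt (real n))"
      \<comment> \<open>Equality holds for positive \<open>n\<close>; for \<open>n = 0\<close>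
        division by zero makes \<open>c\<close> equal to 0.\<close>
      have c2: "c\<^sup>2 * real n ^ 3 \<le> 1"
        by (cases "n = 0") (simp_all add: c_def power_divide power_mult_distrib power2_eq_square power3_eq_cube)
      have "(norm ((1 / sqrt (real n)) *\<^sub>R erw_center xs n))\<^sup>2
         = (\<Sum>i\<in>UNIV. c\<^sup>2 * (\<Sum>k=1..n. \<Sum>j<k. axis i 1 \<bullet> dir_vec (xs ! j))\<^sup>2)" for xs :: "('d \<times> bool) list"
      proof -
        \<comment> \<open>Splitting the norm into coordinates allows the scalar bound to be used
          with \<open>u = axis i 1\<close> and \<open>K = 1\<close>.\<close>
        have "(norm y)\<^sup>2 = (\<Sum>i\<in>UNIV. (axis i 1 \<bullet> y)\<^sup>2)" for y :: "real ^ 'd"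
          by (simp add: norm_vec_def L2_set_def sum_nonneg inner_axis')
        then show ?thesis by (simp only: inner_scaled_center c_def power_mult_distrib)
      qed
      then have "measure_pmf.expectation (M n) (\<lambda>x. (norm x)\<^sup>2)
        = (\<Sum>i\<in>UNIV. c\<^sup>2 * measure_pmf.expectation (erw_steps p n)
            (\<lambda>xs. (\<Sum>k=1..n. \<Sum>j<k. axis (i::'d) 1 \<bullet> dir_vec (xs ! j))\<^sup>2))"
        unfolding M_def integral_map_pmf by simp
      also have "\<dots> \<le> (\<Sum>i\<in>(UNIV :: 'd set). c\<^sup>2 * (1\<^sup>2 * second_moment_const * real n ^ 3))"
        using abs_inner_dir_vec_le[of "axis _ 1"]
        by (intro sum_mono mult_left_mono center_second_moment_bound sum_inner_dir_vec) auto
      also have "\<dots> = D * second_moment_const * (c\<^sup>2 * real n ^ 3)" by (simp add: D_def)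
      also have "\<dots> \<le> D * second_moment_const * 1"
        using D second_moment_const_ge_0 by (intro mult_left_mono c2) auto
      finally show ?thesis by simp
    qed
  qed
  then show ?thesis by (simp add: M_def s2_def D_def)
qed

end
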